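(* Let $\mathscr{A}$ be an additive, extension closed subcategory of a triangulated category $\mathscr{C}$, and assume that $\mathscr{A}$ satisfies condition $E_2$, that is, $\mathscr{C}(\mathscr{A},\Sigma^{-1}\mathscr{A}) = 0$ and $\mathscr{C}(\mathscr{A},\Sigma^{-2}\mathscr{A}) = 0$. Then $\mathscr{A}$ is a proper abelian subcategory of $\mathscr{C}$ if and only if $\mathscr{A} * \Sigma\mathscr{A} \subseteq \Sigma\mathscr{A} * \mathscr{A}$.
   Context: $\Sigma$ denotes the suspension functor of a triangulated category $\mathscr{C}$. An additive subcategory is a full subcategory closed under isomorphisms, direct sums, and direct summands. A short triangle is a diagram $c' \xrightarrow{\gamma'} c \xrightarrow{\gamma} c''$ in $\mathscr{C}$ for which there is a triangle $c' \xrightarrow{\gamma'} c \xrightarrow{\gamma} c'' \xrightarrow{\gamma''} \Sigma c'$. For full subcategories $\mathscr{X},\mathscr{Y} \subseteq \mathscr{C}$, $\mathscr{X} * \mathscr{Y}$ is the full subcategory of those $e \in \mathscr{C}$ for which there is a short triangle $x \to e \to y$ with $x \in \mathscr{X}$, $y \in \mathscr{Y}$. $\mathscr{X}$ is extension closed in $\mathscr{C}$ if $\mathscr{X} * \mathscr{X} \subseteq \mathscr{X}$. Proper abelian subcategory: an additive subcategory $\mathscr{A}$ of $\mathscr{C}$ which is abelian and satisfies that $0 \to a' \xrightarrow{\alpha'} a \xrightarrow{\alpha} a'' \to 0$ is a short exact sequence in $\mathscr{A}$ if and only if $a',a,a''$ are in $\mathscr{A}$ and there is a triangle $a' \xrightarrow{\alpha'}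 a \xrightarrow{\alpha} a'' \to \Sigma a'$ in $\mathscr{C}$. *)

theory Defs
  imports "HOL-Algebra.Group"
begin

section \<open>Categories\<close>

record ('o, 'm) cat =
  obj :: "'o set"
  arr :: "'m set"
  src :: "'m \<Rightarrow> 'o"
  tgt :: "'m \<Rightarrow> 'o"
  ident :: "'o \<Rightarrow> 'm"
  cmp :: "'m \<Rightarrow> 'm \<Rightarrow> 'm" (infixl "\<cdot>\<index>" 70)

definition hom_set :: "('o, 'm, 'x) cat_scheme \<Rightarrow> 'o \<Rightarrow> 'o \<Rightarrow> 'm set" where
  "hom_set C a b = {f \<in> arr C. src C f = a \<and> tgt C f = b}"

locale category =
  fixes C :: "('o, 'm, 'x) cat_scheme" (structure)
  assumes src_obj: "f \<in> arr C \<Longrightarrow> src C f \<in> obj C"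
    and tgt_obj: "f \<in> arr C \<Longrightarrow> tgt C f \<in> obj C"
    and ident_hom: "a \<in> obj C \<Longrightarrow> ident C a \<in> hom_set C a a"
    and cmp_hom: "f \<in> hom_set C a b \<Longrightarrow> g \<in> hom_set C b c \<Longrightarrow> g \<cdot> f \<in> hom_set C a c"
    and cmp_ident_right: "f \<in> hom_set C a b \<Longrightarrow> f \<cdot> ident C a = f"
    and cmp_ident_left: "f \<in> hom_set C a b \<Longrightarrow> ident C b \<cdot> f = f"
    and cmp_assoc: "f \<in> hom_set C a b \<Longrightarrow> g \<in> hom_set C b c \<Longrightarrow> h \<in> hom_set C c d \<Longrightarrow>
      (h \<cdot> g) \<cdot> f = h \<cdot> (g \<cdot> f)"

definition is_iso :: "('o, 'm, 'x) cat_scheme \<Rightarrow> 'm \<Rightarrow> bool" where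
  "is_iso C f \<longleftrightarrow> f \<in> arr C \<and>
    (\<exists>g \<in> hom_set C (tgt C f) (src C f).
      g \<cdot>\<^bsub>C\<^esub> f = ident C (src C f) \<and> f \<cdot>\<^bsub>C\<^esub> g = ident C (tgt C f))"

definition isomorphic :: "('o, 'm, 'x) cat_scheme \<Rightarrow> 'o \<Rightarrow> 'o \<Rightarrow> bool" where
  "isomorphic C a b \<longleftrightarrow> (\<exists>f \<in> hom_set C a b. is_iso C f)"

definition is_mono :: "('o, 'm, 'x) cat_scheme \<Rightarrow> 'm \<Rightarrow> bool" where
  "is_mono C f \<longleftrightarrow> f \<in> arr C \<and>
    (\<forall>x \<in> obj C. \<forall>s \<in> hom_set C x (src C f). \<forall>t \<in> hom_set C x (src C f).
      f \<cdot>\<^bsub>C\<^esub> s = f \<cdot>\<^bsub>C\<^esub> t \<longrightarrow> s = t)"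

definition is_epi :: "('o, 'm, 'x) cat_scheme \<Rightarrow> 'm \<Rightarrow> bool" where
  "is_epi C f \<longleftrightarrow> f \<in> arr C \<and>
    (\<forall>x \<in> obj C. \<forall>s \<in> hom_set C (tgt C f) x. \<forall>t \<in> hom_set C (tgt C f) x.
      s \<cdot>\<^bsub>C\<^esub> f = t \<cdot>\<^bsub>C\<^esub> f \<longrightarrow> s = t)"

definition zero_object :: "('o, 'm, 'x) cat_scheme \<Rightarrow> 'o \<Rightarrow> bool" where
  "zero_object C z \<longleftrightarrow> z \<in> obj C \<and>
    (\<forall>a \<in> obj C. (\<exists>!f. f \<in> hom_set C z a) \<and> (\<exists>!f. f \<in> hom_set C a z))"

definition full_subcategory :: "('o, 'm, 'x) cat_scheme \<Rightarrow> 'o set \<Rightarrow> ('o, 'm, 'x) cat_scheme" where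
  "full_subcategory C A = C\<lparr>obj := A, arr := {f \<in> arr C. src C f \<in> A \<and> tgt C f \<in> A}\<rparr>"


section \<open>Additive categories\<close>

record ('o, 'm) pcat = "('o, 'm) cat" +
  padd :: "'m \<Rightarrow> 'm \<Rightarrow> 'm" (infixl "\<^bold>+\<index>" 65)
  pzero :: "'o \<Rightarrow> 'o \<Rightarrow> 'm"

definition hom_group :: "('o, 'm, 'x) pcat_scheme \<Rightarrow> 'o \<Rightarrow> 'o \<Rightarrow> 'm monoid" where
  "hom_group C a b = \<lparr>carrier = hom_set C a b, monoid.mult = padd C, one = pzero C a b\<rparr>"

definition pneg :: "('o, 'm, 'x) pcat_scheme \<Rightarrow> 'm \<Rightarrow> 'm" where
  "pneg C f = inv\<^bsub>hom_group C (src C f) (tgt C f)\<^esub> f"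

locale preadditive_category = category C for C :: "('o, 'm, 'x) pcat_scheme" (structure) +
  assumes hom_comm_group: "a \<in> obj C \<Longrightarrow> b \<in> obj C \<Longrightarrow> comm_group (hom_group C a b)"
    and cmp_add_left: "f \<in> hom_set C a b \<Longrightarrow> f' \<in> hom_set C a b \<Longrightarrow> g \<in> hom_set C b c \<Longrightarrow>
      g \<cdot> (f \<^bold>+ f') = (g \<cdot> f) \<^bold>+ (g \<cdot> f')"
    and cmp_add_right: "f \<in> hom_set C a b \<Longrightarrow> g \<in> hom_set C b c \<Longrightarrow> g' \<in> hom_set C b c \<Longrightarrow>
      (g \<^bold>+ g') \<cdot> f = (g \<cdot> f) \<^bold>+ (g' \<cdot> f)"

definition is_direct_sum :: "('o, 'm, 'x) pcat_scheme \<Rightarrow> 'o \<Rightarrow> 'o \<Rightarrow> 'o \<Rightarrow> bool" where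
  "is_direct_sum C a b s \<longleftrightarrow> a \<in> obj C \<and> b \<in> obj C \<and> s \<in> obj C \<and>
    (\<exists>i \<in> hom_set C a s. \<exists>j \<in> hom_set C b s. \<exists>p \<in> hom_set C s a. \<exists>q \<in> hom_set C s b.
      p \<cdot>\<^bsub>C\<^esub> i = ident C a \<and> q \<cdot>\<^bsub>C\<^esub> j = ident C b \<and>
      p \<cdot>\<^bsub>C\<^esub> j = pzero C b a \<and> q \<cdot>\<^bsub>C\<^esub> i = pzero C a b \<and>
      (i \<cdot>\<^bsub>C\<^esub> p) \<^bold>+\<^bsub>C\<^esub> (j \<cdot>\<^bsub>C\<^esub> q) = ident C s)"

locale additive_category = preadditive_category C for C :: "('o, 'm, 'x) pcat_scheme" (structure) +
  assumes ex_zero_object: "\<exists>z. zero_object C z"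
    and ex_direct_sum: "a \<in> obj C \<Longrightarrow> b \<in> obj C \<Longrightarrow> \<exists>s. is_direct_sum C a b s"

text \<open>
  Full subcategories are given by their sets of objects. Closure under (finite) direct sums
  includes the empty direct sum, that is, the zero object.
\<close>

definition additive_subcategory :: "('o, 'm, 'x) pcat_scheme \<Rightarrow> 'o set \<Rightarrow> bool" where
  "additive_subcategory C A \<longleftrightarrow> A \<subseteq> obj C \<and>
    (\<forall>a \<in> A. \<forall>b \<in> obj C. isomorphic C a b \<longrightarrow> b \<in> A) \<and>
    (\<forall>z. zero_object C z \<longrightarrow> z \<in> A) \<and>
    (\<forall>a \<in> A. \<forall>b \<in> A. \<forall>s. is_direct_sum C a b s \<longrightarrow> s \<in> A) \<and>
    (\<forall>s \<in> A. \<forall>a b. is_direct_sum C a b s \<longrightarrow> a \<in> A \<and> b \<in> A)"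

definition hom_vanishes :: "('o, 'm, 'x) pcat_scheme \<Rightarrow> 'o set \<Rightarrow> 'o set \<Rightarrow> bool" where
  "hom_vanishes C X Y \<longleftrightarrow> (\<forall>x \<in> X. \<forall>y \<in> Y. hom_set C x y = {pzero C x y})"


section \<open>Abelian categories\<close>

definition is_kernel :: "('o, 'm, 'x) pcat_scheme \<Rightarrow> 'm \<Rightarrow> 'm \<Rightarrow> bool" where
  "is_kernel C k f \<longleftrightarrow> f \<in> arr C \<and> k \<in> arr C \<and> tgt C k = src C f \<and>
    f \<cdot>\<^bsub>C\<^esub> k = pzero C (src C k) (tgt C f) \<and>
    (\<forall>x \<in> obj C. \<forall>t \<in> hom_set C x (src C f). f \<cdot>\<^bsub>C\<^esub> t = pzero C x (tgt C f) \<longrightarrow>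
      (\<exists>!u. u \<in> hom_set C x (src C k) \<and> k \<cdot>\<^bsub>C\<^esub> u = t))"

definition is_cokernel :: "('o, 'm, 'x) pcat_scheme \<Rightarrow> 'm \<Rightarrow> 'm \<Rightarrow> bool" where
  "is_cokernel C c f \<longleftrightarrow> f \<in> arr C \<and> c \<in> arr C \<and> src C c = tgt C f \<and>
    c \<cdot>\<^bsub>C\<^esub> f = pzero C (src C f) (tgt C c) \<and>
    (\<forall>x \<in> obj C. \<forall>t \<in> hom_set C (tgt C f) x. t \<cdot>\<^bsub>C\<^esub> f = pzero C (src C f) x \<longrightarrow>
      (\<exists>!u. u \<in> hom_set C (tgt C c) x \<and> u \<cdot>\<^bsub>C\<^esub> c = t))"

locale abelian_category = additive_category C for C :: "('o, 'm, 'x) pcat_scheme" (structure) +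
  assumes ex_kernel: "f \<in> arr C \<Longrightarrow> \<exists>k. is_kernel C k f"
    and ex_cokernel: "f \<in> arr C \<Longrightarrow> \<exists>c. is_cokernel C c f"
    and mono_is_kernel: "is_mono C f \<Longrightarrow> \<exists>g. is_kernel C f g"
    and epi_is_cokernel: "is_epi C f \<Longrightarrow> \<exists>g. is_cokernel C f g"

text \<open>The image of a morphism is the kernel of its cokernel.\<close>

definition is_image :: "('o, 'm, 'x) pcat_scheme \<Rightarrow> 'm \<Rightarrow> 'm \<Rightarrow> bool" where
  "is_image C m f \<longleftrightarrow> (\<exists>c. is_cokernel C c f \<and> is_kernel C m c)"

text \<open>
  Kernels and images are determined up to isomorphism only, so ``image of \<open>f\<close> equals kernel
  of \<open>g\<close>'' says that some morphism is both.
\<close>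

definition exact_at :: "('o, 'm, 'x) pcat_scheme \<Rightarrow> 'm \<Rightarrow> 'm \<Rightarrow> bool" where
  "exact_at C f g \<longleftrightarrow> f \<in> arr C \<and> g \<in> arr C \<and> tgt C f = src C g \<and>
    (\<exists>m. is_image C m f \<and> is_kernel C m g)"

definition short_exact :: "('o, 'm, 'x) pcat_scheme \<Rightarrow> 'm \<Rightarrow> 'm \<Rightarrow> bool" where
  "short_exact C f g \<longleftrightarrow>
    (\<exists>z. zero_object C z \<and> exact_at C (pzero C z (src C f)) f \<and> exact_at C f g \<and>
      exact_at C g (pzero C (tgt C g) z))"


section \<open>Endofunctors\<close>

record ('o, 'm) endo =
  on_obj :: "'o \<Rightarrow> 'o"
  on_arr :: "'m \<Rightarrow> 'm"

definition id_endo :: "('o, 'm) endo" where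
  "id_endo = \<lparr>on_obj = id, on_arr = id\<rparr>"

definition comp_endo :: "('o, 'm) endo \<Rightarrow> ('o, 'm) endo \<Rightarrow> ('o, 'm) endo" where
  "comp_endo F G = \<lparr>on_obj = on_obj F \<circ> on_obj G, on_arr = on_arr F \<circ> on_arr G\<rparr>"

definition is_functor :: "('o, 'm, 'x) cat_scheme \<Rightarrow> ('o, 'm) endo \<Rightarrow> bool" where
  "is_functor C F \<longleftrightarrow>
    (\<forall>a \<in> obj C. on_obj F a \<in> obj C \<and> on_arr F (ident C a) = ident C (on_obj F a)) \<and>
    (\<forall>a \<in> obj C. \<forall>b \<in> obj C. \<forall>f \<in> hom_set C a b.
      on_arr F f \<in> hom_set C (on_obj F a) (on_obj F b)) \<and>
    (\<forall>f \<in> arr C. \<forall>g \<in> arr C. tgt C f = src C g \<longrightarrow>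
      on_arr F (g \<cdot>\<^bsub>C\<^esub> f) = on_arr F g \<cdot>\<^bsub>C\<^esub> on_arr F f)"

definition is_additive_functor :: "('o, 'm, 'x) pcat_scheme \<Rightarrow> ('o, 'm) endo \<Rightarrow> bool" where
  "is_additive_functor C F \<longleftrightarrow> is_functor C F \<and>
    (\<forall>a \<in> obj C. \<forall>b \<in> obj C. \<forall>f \<in> hom_set C a b. \<forall>g \<in> hom_set C a b.
      on_arr F (f \<^bold>+\<^bsub>C\<^esub> g) = on_arr F f \<^bold>+\<^bsub>C\<^esub> on_arr F g)"

definition naturally_isomorphic ::
    "('o, 'm, 'x) cat_scheme \<Rightarrow> ('o, 'm) endo \<Rightarrow> ('o, 'm) endo \<Rightarrow> bool" where
  "naturally_isomorphic C F G \<longleftrightarrow>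
    (\<exists>\<eta>. (\<forall>a \<in> obj C. \<eta> a \<in> hom_set C (on_obj F a) (on_obj G a) \<and> is_iso C (\<eta> a)) \<and>
      (\<forall>f \<in> arr C. \<eta> (tgt C f) \<cdot>\<^bsub>C\<^esub> on_arr F f = on_arr G f \<cdot>\<^bsub>C\<^esub> \<eta> (src C f)))"


section \<open>Triangulated categories\<close>

text \<open>
  The suspension is an additive autoequivalence; \<open>desusp\<close> is a chosen quasi-inverse. The case
  where the suspension is an automorphism with a strict inverse is included. An element
  \<open>(f, g, h)\<close> of \<open>tri\<close> is a (distinguished) triangle.
\<close>

record ('o, 'm) tricat = "('o, 'm) pcat" +
  susp :: "('o, 'm) endo"
  desusp :: "('o, 'm) endo"
  tri :: "('m \<times> 'm \<times> 'm) set"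

abbreviation susp_obj :: "('o, 'm, 'x) tricat_scheme \<Rightarrow> 'o \<Rightarrow> 'o" ("\<Sigma>o\<index>") where
  "\<Sigma>o\<^bsub>C\<^esub> \<equiv> on_obj (susp C)"

abbreviation susp_arr :: "('o, 'm, 'x) tricat_scheme \<Rightarrow> 'm \<Rightarrow> 'm" ("\<Sigma>a\<index>") where
  "\<Sigma>a\<^bsub>C\<^esub> \<equiv> on_arr (susp C)"

abbreviation desusp_obj :: "('o, 'm, 'x) tricat_scheme \<Rightarrow> 'o \<Rightarrow> 'o" where
  "desusp_obj C \<equiv> on_obj (desusp C)"

locale triangulated_category = additive_category C
  for C :: "('o, 'm, 'x) tricat_scheme" (structure) +
  assumes susp_functor: "is_additive_functor C (susp C)"
    and desusp_functor: "is_functor C (desusp C)"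
    and susp_desusp: "naturally_isomorphic C (comp_endo (susp C) (desusp C)) id_endo"
    and desusp_susp: "naturally_isomorphic C (comp_endo (desusp C) (susp C)) id_endo"
    and tri_shape: "(f, g, h) \<in> tri C \<Longrightarrow>
      \<exists>x y z. f \<in> hom_set C x y \<and> g \<in> hom_set C y z \<and> h \<in> hom_set C z (\<Sigma>o x)"
    and TR1_ident: "x \<in> obj C \<Longrightarrow> zero_object C z \<Longrightarrow>
      (ident C x, pzero C x z, pzero C z (\<Sigma>o x)) \<in> tri C"
    and TR1_complete: "f \<in> arr C \<Longrightarrow> \<exists>g h. (f, g, h) \<in> tri C"
    and TR1_iso: "\<lbrakk> (f, g, h) \<in> tri C;
        f \<in> hom_set C x y; g \<in> hom_set C y z; h \<in> hom_set C z (\<Sigma>o x);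
        f' \<in> hom_set C x' y'; g' \<in> hom_set C y' z'; h' \<in> hom_set C z' (\<Sigma>o x');
        u \<in> hom_set C x x'; v \<in> hom_set C y y'; w \<in> hom_set C z z';
        is_iso C u; is_iso C v; is_iso C w;
        v \<cdot> f = f' \<cdot> u; w \<cdot> g = g' \<cdot> v; \<Sigma>a u \<cdot> h = h' \<cdot> w \<rbrakk> \<Longrightarrow> (f', g', h') \<in> tri C"
    and TR2: "\<lbrakk> f \<in> hom_set C x y; g \<in> hom_set C y z; h \<in> hom_set C z (\<Sigma>o x) \<rbrakk> \<Longrightarrow>
      (f, g, h) \<in> tri C \<longleftrightarrow> (g, h, pneg C (\<Sigma>a f)) \<in> tri C"
    and TR3: "\<lbrakk> (f, g, h) \<in> tri C; (f', g', h') \<in> tri C;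
        f \<in> hom_set C x y; g \<in> hom_set C y z; h \<in> hom_set C z (\<Sigma>o x);
        f' \<in> hom_set C x' y'; g' \<in> hom_set C y' z'; h' \<in> hom_set C z' (\<Sigma>o x');
        u \<in> hom_set C x x'; v \<in> hom_set C y y'; v \<cdot> f = f' \<cdot> u \<rbrakk> \<Longrightarrow>
      \<exists>w \<in> hom_set C z z'. w \<cdot> g = g' \<cdot> v \<and> \<Sigma>a u \<cdot> h = h' \<cdot> w"
    and TR4: "\<lbrakk> (u, j, k) \<in> tri C; (v, l, i) \<in> tri C; (v \<cdot> u, m, n) \<in> tri C;
        u \<in> hom_set C x y; v \<in> hom_set C y z;
        j \<in> hom_set C y z'; k \<in> hom_set C z' (\<Sigma>o x);
        l \<in> hom_set C z x'; i \<in> hom_set C x' (\<Sigma>o y);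
        m \<in> hom_set C z y'; n \<in> hom_set C y' (\<Sigma>o x) \<rbrakk> \<Longrightarrow>
      \<exists>f \<in> hom_set C z' y'. \<exists>g \<in> hom_set C y' x'.
        (f, g, \<Sigma>a j \<cdot> i) \<in> tri C \<and>
        f \<cdot> j = m \<cdot> v \<and> n \<cdot> f = k \<and> g \<cdot> m = l \<and> i \<cdot> g = \<Sigma>a u \<cdot> n"

definition short_triangle :: "('o, 'm, 'x) tricat_scheme \<Rightarrow> 'm \<Rightarrow> 'm \<Rightarrow> bool" where
  "short_triangle C f g \<longleftrightarrow> (\<exists>h. (f, g, h) \<in> tri C)"

definition star :: "('o, 'm, 'x) tricat_scheme \<Rightarrow> 'o set \<Rightarrow> 'o set \<Rightarrow> 'o set" where
  "star C X Y = {e \<in> obj C. \<exists>x \<in> X. \<exists>y \<in> Y. \<exists>f \<in> hom_set C x e. \<exists>g \<in> hom_set C e y.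
    short_triangle C f g}"

definition extension_closed :: "('o, 'm, 'x) tricat_scheme \<Rightarrow> 'o set \<Rightarrow> bool" where
  "extension_closed C X \<longleftrightarrow> star C X X \<subseteq> X"

definition condition_E2 :: "('o, 'm, 'x) tricat_scheme \<Rightarrow> 'o set \<Rightarrow> bool" where
  "condition_E2 C A \<longleftrightarrow>
    hom_vanishes C A (desusp_obj C ` A) \<and>
    hom_vanishes C A (desusp_obj C ` desusp_obj C ` A)"

definition proper_abelian_subcategory :: "('o, 'm, 'x) tricat_scheme \<Rightarrow> 'o set \<Rightarrow> bool" where
  "proper_abelian_subcategory C A \<longleftrightarrow>
    additive_subcategory C A \<and>
    abelian_category (full_subcategory C A) \<and>
    (\<forall>f \<in> arr C. \<forall>g \<in> arr C.
      short_exact (full_subcategory C A) f g \<longleftrightarrow>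
      src C f \<in> A \<and> tgt C f \<in> A \<and> tgt C g \<in> A \<and> short_triangle C f g)"

end

theory Submission
  imports Defs
begin

text \<open>
  Condition \<open>E\<^sub>2\<close> says that there are no nonzero morphisms from \<open>\<Sigma>A\<close> or \<open>\<Sigma>\<^sup>2A\<close> to \<open>A\<close>. If the cone
  \<open>c\<close> of a morphism \<open>f: a \<rightarrow> b\<close> of \<open>A\<close> sits in a triangle \<open>\<Sigma>k \<rightarrow> c \<rightarrow> q \<rightarrow> \<Sigma>\<^sup>2k\<close> with \<open>k\<close> and \<open>q\<close> in \<open>A\<close>,
  then by this vanishing the composite \<open>b \<rightarrow> c \<rightarrow> q\<close> is a cokernel of \<open>f\<close> and the desuspension of
  \<open>\<Sigma>k \<rightarrow> c \<rightarrow> \<Sigma>a\<close> is a kernel. For \<open>f\<close> mono, \<open>k = 0\<close> and \<open>c\<close> lies in \<open>A\<close>; for \<open>f\<close> epi, \<open>q = 0\<close> and \<open>c\<close> is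
  isomorphic to \<open>\<Sigma>k\<close>; either way \<open>f\<close> is part of a short triangle in \<open>A\<close>, and every such triangle
  consists of a kernel and a cokernel of each other. Conversely, if \<open>A\<close> is proper abelian, the
  octahedral axiom applied to an epi-mono factorization of \<open>f\<close> decomposes the cone of \<open>f\<close> as required.
\<close>

section \<open>Preadditive categories\<close>

context category
begin

lemma hom_obj:
  assumes "f \<in> hom_set C a b"
  shows "a \<in> obj C" "b \<in> obj C"
  using assms src_obj tgt_obj by (auto simp: hom_set_def)

lemma is_iso_iff:
  assumes "f \<in> hom_set C a b"
  shows "is_iso C f \<longleftrightarrow> (\<exists>g \<in> hom_set C b a. g \<cdot> f = ident C a \<and> f \<cdot> g = ident C b)"
  using assms by (auto simp: is_iso_def hom_set_def)

lemma is_iso_ident: "a \<in> obj C \<Longrightarrow> is_iso C (ident C a)"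
  using is_iso_iff[OF ident_hom] ident_hom cmp_ident_left by metis

lemma isomorphicI:
  assumes "f \<in> hom_set C a b" "g \<in> hom_set C b a" "g \<cdot> f = ident C a" "f \<cdot> g = ident C b"
  shows "isomorphic C a b"
  using assms is_iso_iff unfolding isomorphic_def by blast

end

context preadditive_category
begin

section \<open>Arithmetic in the hom groups\<close>

lemma add_hom:
  assumes "f \<in> hom_set C a b" "g \<in> hom_set C a b"
  shows "f \<^bold>+ g \<in> hom_set C a b"
proof -
  interpret G: comm_group "hom_group C a b" using hom_comm_group hom_obj assms by blast
  show ?thesis using G.m_closed[of f g] assms by (simp add: hom_group_def)
qed

lemma zero_hom:
  assumes "a \<in> obj C" "b \<in> obj C"
  shows "pzero C a b \<in> hom_set C a b"
proof -
  interpret G: comm_group "hom_group C a b" using hom_comm_group assms by blast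
  show ?thesis using G.one_closed by (simp add: hom_group_def)
qed

lemma neg_hom:
  assumes "f \<in> hom_set C a b"
  shows "pneg C f \<in> hom_set C a b"
proof -
  interpret G: comm_group "hom_group C a b" using hom_comm_group hom_obj assms by blast
  show ?thesis using G.inv_closed[of f] assms by (simp add: hom_group_def pneg_def hom_set_def)
qed

lemma add_neg:
  assumes "f \<in> hom_set C a b"
  shows "f \<^bold>+ pneg C f = pzero C a b"
proof -
  interpret G: comm_group "hom_group C a b" using hom_comm_group hom_obj assms by blast
  show ?thesis using G.r_inv[of f] assms by (simp add: hom_group_def pneg_def hom_set_def)
qed

lemma neg_unique:
  assumes "f \<in> hom_set C a b" "g \<in> hom_set C a b" "f \<^bold>+ g = pzero C a b"
  shows "g = pneg C f"
proof -
  interpret G: comm_group "hom_group C a b" using hom_comm_group hom_obj assms by blast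
  have "g = inv\<^bsub>hom_group C a b\<^esub> f"
    using G.inv_equality[of g f] G.m_comm[of f g] assms by (simp add: hom_group_def)
  then show ?thesis using assms by (simp add: pneg_def hom_set_def)
qed

lemma neg_neg:
  assumes "f \<in> hom_set C a b"
  shows "pneg C (pneg C f) = f"
proof -
  interpret G: comm_group "hom_group C a b" using hom_comm_group hom_obj assms by blast
  have "f \<^bold>+ pneg C f = pneg C f \<^bold>+ f"
    using G.m_comm[of f "pneg C f"] assms neg_hom[OF assms] by (simp add: hom_group_def)
  then show ?thesis using neg_unique[OF neg_hom[OF assms] assms] add_neg[OF assms] by simp
qed

lemma diff_eq_zero:
  assumes "f \<in> hom_set C a b" "g \<in> hom_set C a b" "f \<^bold>+ pneg C g = pzero C a b"
  shows "f = g"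
  using neg_unique[OF assms(1) neg_hom[OF assms(2)] assms(3)] neg_neg assms(1,2) by metis

lemma add_zero:
  assumes "f \<in> hom_set C a b"
  shows "f \<^bold>+ pzero C a b = f"
proof -
  interpret G: comm_group "hom_group C a b" using hom_comm_group hom_obj assms by blast
  show ?thesis using G.r_one[of f] assms by (simp add: hom_group_def)
qed

text \<open>An additive map sends zero to an idempotent of a hom group;
  \<open>cmp_zero_right\<close>, \<open>cmp_zero_left\<close> and \<open>susp_zero\<close> all come
  from this.\<close>

lemma add_idem_zero:
  assumes "f \<in> hom_set C a b" "f \<^bold>+ f = f"
  shows "f = pzero C a b"
proof -
  interpret G: comm_group "hom_group C a b" using hom_comm_group hom_obj assms by blast
  show ?thesis using G.l_cancel_one'[of f f] assms by (simp add: hom_group_def)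
qed

lemma neg_zero: "a \<in> obj C \<Longrightarrow> b \<in> obj C \<Longrightarrow> pneg C (pzero C a b) = pzero C a b"
  using neg_unique[OF zero_hom zero_hom] add_zero zero_hom by metis

lemma cmp_zero_right:
  assumes "g \<in> hom_set C b c" "a \<in> obj C"
  shows "g \<cdot> pzero C a b = pzero C a c"
proof -
  have z: "pzero C a b \<in> hom_set C a b" using zero_hom hom_obj assms by blast
  show ?thesis
    using add_idem_zero[OF cmp_hom[OF z assms(1)]] cmp_add_left[OF z z assms(1)] add_zero[OF z]
    by simp
qed

lemma cmp_zero_left:
  assumes "f \<in> hom_set C a b" "c \<in> obj C"
  shows "pzero C b c \<cdot> f = pzero C a c"
proof -
  have z: "pzero C b c \<in> hom_set C b c" using zero_hom hom_obj assms by blast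
  show ?thesis
    using add_idem_zero[OF cmp_hom[OF assms(1) z]] cmp_add_right[OF assms(1) z z] add_zero[OF z]
    by simp
qed

lemma cmp_neg_right:
  assumes "f \<in> hom_set C a b" "g \<in> hom_set C b c"
  shows "g \<cdot> pneg C f = pneg C (g \<cdot> f)"
  using neg_unique[OF cmp_hom[OF assms] cmp_hom[OF neg_hom[OF assms(1)] assms(2)]]
    cmp_add_left[OF assms(1) neg_hom[OF assms(1)] assms(2)] add_neg[OF assms(1)]
    cmp_zero_right[OF assms(2)] hom_obj[OF assms(1)] by simp

lemma cmp_neg_left:
  assumes "f \<in> hom_set C a b" "g \<in> hom_set C b c"
  shows "pneg C g \<cdot> f = pneg C (g \<cdot> f)"
  using neg_unique[OF cmp_hom[OF assms] cmp_hom[OF assms(1) neg_hom[OF assms(2)]]]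
    cmp_add_right[OF assms(1,2) neg_hom[OF assms(2)]] add_neg[OF assms(2)]
    cmp_zero_left[OF assms(1)] hom_obj[OF assms(2)] by simp

lemma neg_eq_zero:
  assumes "f \<in> hom_set C a b" "pneg C f = pzero C a b"
  shows "f = pzero C a b"
  using neg_neg[OF assms(1)] assms(2) neg_zero[of a b] hom_obj[OF assms(1)] by simp

section \<open>Monomorphisms, epimorphisms, kernels and cokernels\<close>

text \<open>Subtract two arrows with equal composites. The quantifier over \<open>x\<close> is
  unrestricted because an element of \<open>hom_set C x a\<close> already makes \<open>x\<close> an
  object.\<close>

lemma is_mono_iff:
  assumes f: "f \<in> hom_set C a b"
  shows "is_mono C f \<longleftrightarrow> (\<forall>x. \<forall>u \<in> hom_set C x a. f \<cdot> u = pzero C x b \<longrightarrow> u = pzero C x a)"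
proof
  assume m: "is_mono C f"
  show "\<forall>x. \<forall>u \<in> hom_set C x a. f \<cdot> u = pzero C x b \<longrightarrow> u = pzero C x a"
  proof (intro allI ballI impI)
    fix x u assume u: "u \<in> hom_set C x a" and z: "f \<cdot> u = pzero C x b"
    have "f \<cdot> u = f \<cdot> pzero C x a" using z cmp_zero_right[OF f] hom_obj[OF u] by simp
    then show "u = pzero C x a"
      using m f u zero_hom[OF hom_obj[OF u]] hom_obj[OF u] by (auto simp: is_mono_def hom_set_def)
  qed
next
  assume r: "\<forall>x. \<forall>u \<in> hom_set C x a. f \<cdot> u = pzero C x b \<longrightarrow> u = pzero C x a"
  have "s = t" if st: "s \<in> hom_set C x a" "t \<in> hom_set C x a" "f \<cdot> s = f \<cdot> t" for x s t
  proof -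
    have "f \<cdot> (s \<^bold>+ pneg C t) = f \<cdot> t \<^bold>+ pneg C (f \<cdot> t)"
      using cmp_add_left[OF st(1) neg_hom[OF st(2)] f] cmp_neg_right[OF st(2) f] st(3) by simp
    also have "\<dots> = pzero C x b" using add_neg[OF cmp_hom[OF st(2) f]] .
    finally show ?thesis using r add_hom[OF st(1) neg_hom[OF st(2)]] diff_eq_zero[OF st(1,2)] by blast
  qed
  then show "is_mono C f" using f unfolding is_mono_def hom_set_def by blast
qed

lemma is_epi_iff:
  assumes f: "f \<in> hom_set C a b"
  shows "is_epi C f \<longleftrightarrow> (\<forall>x. \<forall>u \<in> hom_set C b x. u \<cdot> f = pzero C a x \<longrightarrow> u = pzero C b x)"
proof
  assume m: "is_epi C f"
  show "\<forall>x. \<forall>u \<in> hom_set C b x. u \<cdot> f = pzero C a x \<longrightarrow> u = pzero C b x"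
  proof (intro allI ballI impI)
    fix x u assume u: "u \<in> hom_set C b x" and z: "u \<cdot> f = pzero C a x"
    have "u \<cdot> f = pzero C b x \<cdot> f" using z cmp_zero_left[OF f] hom_obj[OF u] by simp
    then show "u = pzero C b x"
      using m f u zero_hom[OF hom_obj[OF u]] hom_obj[OF u] by (auto simp: is_epi_def hom_set_def)
  qed
next
  assume r: "\<forall>x. \<forall>u \<in> hom_set C b x. u \<cdot> f = pzero C a x \<longrightarrow> u = pzero C b x"
  have "s = t" if st: "s \<in> hom_set C b x" "t \<in> hom_set C b x" "s \<cdot> f = t \<cdot> f" for x s t
  proof -
    have "(s \<^bold>+ pneg C t) \<cdot> f = t \<cdot> f \<^bold>+ pneg C (t \<cdot> f)"
      using cmp_add_right[OF f st(1) neg_hom[OF st(2)]] cmp_neg_left[OF f st(2)] st(3) by simp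
    also have "\<dots> = pzero C a x" using add_neg[OF cmp_hom[OF f st(2)]] .
    finally show ?thesis using r add_hom[OF st(1) neg_hom[OF st(2)]] diff_eq_zero[OF st(1,2)] by blast
  qed
  then show "is_epi C f" using f unfolding is_epi_def hom_set_def by blast
qed

lemma mono_cancel:
  assumes "is_mono C f" "f \<in> hom_set C a b" "s \<in> hom_set C x a" "t \<in> hom_set C x a" "f \<cdot> s = f \<cdot> t"
  shows "s = t"
  using assms hom_obj(1)[OF assms(3)] by (auto simp: is_mono_def hom_set_def)

lemma epi_cancel:
  assumes "is_epi C f" "f \<in> hom_set C a b" "s \<in> hom_set C b x" "t \<in> hom_set C b x" "s \<cdot> f = t \<cdot> f"
  shows "s = t"
  using assms hom_obj(2)[OF assms(3)] by (auto simp: is_epi_def hom_set_def)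

text \<open>Uniqueness of the factorization amounts to left cancellation for \<open>k\<close>.
  Existence is kept apart because triangles deliver existence by themselves, whereas uniqueness will
  come from vanishing of morphisms.\<close>

lemma is_kernel_iff:
  assumes k: "k \<in> hom_set C x a" and f: "f \<in> hom_set C a b"
  shows "is_kernel C k f \<longleftrightarrow> f \<cdot> k = pzero C x b \<and> is_mono C k \<and>
    (\<forall>y. \<forall>t \<in> hom_set C y a. f \<cdot> t = pzero C y b \<longrightarrow> (\<exists>u \<in> hom_set C y x. k \<cdot> u = t))"
    (is "_ \<longleftrightarrow> ?r")
proof -
  have un: "is_kernel C k f \<longleftrightarrow> f \<cdot> k = pzero C x b \<and>
    (\<forall>y \<in> obj C. \<forall>t \<in> hom_set C y a. f \<cdot> t = pzero C y b \<longrightarrow>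
      (\<exists>!u. u \<in> hom_set C y x \<and> k \<cdot> u = t))"
    using k f by (auto simp: is_kernel_def hom_set_def)
  show ?thesis
  proof
    assume ker: "is_kernel C k f"
    have z: "f \<cdot> k = pzero C x b" using ker un by blast
    have "u = pzero C y x" if u: "u \<in> hom_set C y x" "k \<cdot> u = pzero C y a" for y u
    proof -
      note o = hom_obj[OF u(1)]
      have "pzero C y a \<in> hom_set C y a" "f \<cdot> pzero C y a = pzero C y b"
        using zero_hom cmp_zero_right[OF f] o hom_obj[OF f] by auto
      then have "\<exists>!u. u \<in> hom_set C y x \<and> k \<cdot> u = pzero C y a" using ker un o by blast
      moreover have "pzero C y x \<in> hom_set C y x" "k \<cdot> pzero C y x = pzero C y a"
        using zero_hom cmp_zero_right[OF k] o by auto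
      ultimately show ?thesis using u by blast
    qed
    then have "is_mono C k" using is_mono_iff[OF k] by blast
    moreover have "\<exists>u \<in> hom_set C y x. k \<cdot> u = t" if "t \<in> hom_set C y a" "f \<cdot> t = pzero C y b" for y t
      using ker un that hom_obj[OF that(1)] by blast
    ultimately show ?r using z by blast
  next
    assume r: ?r
    have "\<exists>!u. u \<in> hom_set C y x \<and> k \<cdot> u = t" if t: "t \<in> hom_set C y a" "f \<cdot> t = pzero C y b" for y t
    proof -
      obtain u where "u \<in> hom_set C y x" "k \<cdot> u = t" using r t by blast
      then show ?thesis using mono_cancel[of k, OF _ k] r by blast
    qed
    then show "is_kernel C k f" unfolding un using r by blast
  qed
qed

lemma is_cokernel_iff:
  assumes c: "c \<in> hom_set C b x" and f: "f \<in> hom_set C a b"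
  shows "is_cokernel C c f \<longleftrightarrow> c \<cdot> f = pzero C a x \<and> is_epi C c \<and>
    (\<forall>y. \<forall>t \<in> hom_set C b y. t \<cdot> f = pzero C a y \<longrightarrow> (\<exists>u \<in> hom_set C x y. u \<cdot> c = t))"
    (is "_ \<longleftrightarrow> ?r")
proof -
  have un: "is_cokernel C c f \<longleftrightarrow> c \<cdot> f = pzero C a x \<and>
    (\<forall>y \<in> obj C. \<forall>t \<in> hom_set C b y. t \<cdot> f = pzero C a y \<longrightarrow>
      (\<exists>!u. u \<in> hom_set C x y \<and> u \<cdot> c = t))"
    using c f by (auto simp: is_cokernel_def hom_set_def)
  show ?thesis
  proof
    assume coker: "is_cokernel C c f"
    have z: "c \<cdot> f = pzero C a x" using coker un by blast
    have "u = pzero C x y" if u: "u \<in> hom_set C x y" "u \<cdot> c = pzero C b y" for y u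
    proof -
      note o = hom_obj[OF u(1)]
      have "pzero C b y \<in> hom_set C b y" "pzero C b y \<cdot> f = pzero C a y"
        using zero_hom cmp_zero_left[OF f] o hom_obj[OF f] by auto
      then have "\<exists>!u. u \<in> hom_set C x y \<and> u \<cdot> c = pzero C b y" using coker un o by blast
      moreover have "pzero C x y \<in> hom_set C x y" "pzero C x y \<cdot> c = pzero C b y"
        using zero_hom cmp_zero_left[OF c] o by auto
      ultimately show ?thesis using u by blast
    qed
    then have "is_epi C c" using is_epi_iff[OF c] by blast
    moreover have "\<exists>u \<in> hom_set C x y. u \<cdot> c = t" if "t \<in> hom_set C b y" "t \<cdot> f = pzero C a y" for y t
      using coker un that hom_obj[OF that(1)] by blast
    ultimately show ?r using z by blast
  next
    assume r: ?r
    have "\<exists>!u. u \<in> hom_set C x y \<and> u \<cdot> c = t" if t: "t \<in> hom_set C b y" "t \<cdot> f = pzero C a y" for y t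
    proof -
      obtain u where "u \<in> hom_set C x y" "u \<cdot> c = t" using r t by blast
      then show ?thesis using epi_cancel[of c, OF _ c] r by blast
    qed
    then show "is_cokernel C c f" unfolding un using r by blast
  qed
qed

lemma is_kernel_hom:
  assumes "is_kernel C k f"
  shows "k \<in> hom_set C (src C k) (src C f)" "f \<in> hom_set C (src C f) (tgt C f)"
  using assms by (auto simp: is_kernel_def hom_set_def)

lemma is_cokernel_hom:
  assumes "is_cokernel C c f"
  shows "c \<in> hom_set C (tgt C f) (tgt C c)" "f \<in> hom_set C (src C f) (tgt C f)"
  using assms by (auto simp: is_cokernel_def hom_set_def)

section \<open>Zero objects and short exact sequences\<close>

lemma zero_object_obj: "zero_object C z \<Longrightarrow> z \<in> obj C"
  by (simp add: zero_object_def)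

lemma to_zero_object:
  assumes "zero_object C z" "f \<in> hom_set C a z"
  shows "f = pzero C a z"
proof -
  have "\<exists>!f. f \<in> hom_set C a z" using assms(1) hom_obj(1)[OF assms(2)] by (simp add: zero_object_def)
  then show ?thesis using zero_hom[OF hom_obj[OF assms(2)]] assms(2) by blast
qed

lemma from_zero_object:
  assumes "zero_object C z" "f \<in> hom_set C z a"
  shows "f = pzero C z a"
proof -
  have "\<exists>!f. f \<in> hom_set C z a" using assms(1) hom_obj(2)[OF assms(2)] by (simp add: zero_object_def)
  then show ?thesis using zero_hom[OF hom_obj[OF assms(2)]] assms(2) by blast
qed

text \<open>Every arrow into or out of \<open>z\<close> equals its composite with
  \<open>ident C z\<close>, hence is zero.\<close>

lemma zero_objectI:
  assumes "z \<in> obj C" "ident C z = pzero C z z"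
  shows "zero_object C z"
proof -
  have from_z: "f = pzero C z a" if "f \<in> hom_set C z a" for a f
    using cmp_ident_right[OF that] cmp_zero_right[OF that assms(1)] assms(2) by simp
  have to_z: "f = pzero C a z" if "f \<in> hom_set C a z" for a f
    using cmp_ident_left[OF that] cmp_zero_left[OF that assms(1)] assms(2) by simp
  have "(\<exists>!f. f \<in> hom_set C z a) \<and> (\<exists>!f. f \<in> hom_set C a z)" if "a \<in> obj C" for a
    using zero_hom[OF assms(1) that] zero_hom[OF that assms(1)] from_z[of _ a] to_z[of _ a] by auto
  then show ?thesis using assms(1) unfolding zero_object_def by blast
qed

text \<open>The witnesses of exactness are: on the left \<open>pzero C z a\<close>, a kernel of its
  own cokernel \<open>ident C a\<close>; in the middle \<open>f\<close> itself; on the right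
  \<open>ident C c\<close>, a kernel of the arrow from \<open>c\<close> to \<open>z\<close>, which
  is a cokernel of \<open>g\<close>.\<close>

lemma short_exactI:
  assumes ker: "is_kernel C f g" and coker: "is_cokernel C g f" and z: "zero_object C z"
  shows "short_exact C f g"
proof -
  define a b c where "a = src C f" and "b = src C g" and "c = tgt C g"
  have f: "f \<in> hom_set C a b" and g: "g \<in> hom_set C b c"
    using is_kernel_hom[OF ker] by (simp_all add: a_def b_def c_def)
  note zo = zero_object_obj[OF z] and a = hom_obj(1)[OF f] and c = hom_obj(2)[OF g]
  note ia = ident_hom[OF a] and ic = ident_hom[OF c]
  have za: "pzero C z a \<in> hom_set C z a" and cz: "pzero C c z \<in> hom_set C c z"
    using zero_hom a c zo by auto
  have mono: "is_mono C f" and epi: "is_epi C g"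
    using ker coker is_kernel_iff[OF f g] is_cokernel_iff[OF g f] by auto
  have mza: "is_mono C (pzero C z a)" using is_mono_iff[OF za] to_zero_object[OF z] by blast
  have ecz: "is_epi C (pzero C c z)" using is_epi_iff[OF cz] from_zero_object[OF z] by blast
  have lift: "\<exists>u \<in> hom_set C y z. pzero C z a \<cdot> u = t"
    if "t \<in> hom_set C y a" "t = pzero C y a" for y t
    using zero_hom[of y z] cmp_zero_left[OF zero_hom[of y z] a] zo hom_obj[OF that(1)] that(2) by auto
  have desc: "\<exists>u \<in> hom_set C z y. u \<cdot> pzero C c z = t"
    if "t \<in> hom_set C c y" "t = pzero C c y" for y t
    using zero_hom[of z y] cmp_zero_right[OF zero_hom[of z y] c] zo hom_obj[OF that(1)] that(2) by auto
  have "is_epi C (ident C a)" unfolding is_epi_iff[OF ia] using cmp_ident_right by auto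
  then have "is_cokernel C (ident C a) (pzero C z a)"
    unfolding is_cokernel_iff[OF ia za] using cmp_ident_left[OF za] cmp_ident_right by blast
  moreover have "is_kernel C (pzero C z a) (ident C a)"
    unfolding is_kernel_iff[OF za ia] using cmp_ident_left mza lift za by simp
  moreover have "is_kernel C (pzero C z a) f"
    unfolding is_kernel_iff[OF za f]
    using mza lift cmp_zero_right[OF f zo] mono is_mono_iff[OF f] by blast
  ultimately have e1: "exact_at C (pzero C z a) f"
    using za f unfolding exact_at_def is_image_def by (auto simp: hom_set_def)
  have e2: "exact_at C f g" using f g ker coker unfolding exact_at_def is_image_def
    by (auto simp: hom_set_def)
  have "is_cokernel C (pzero C c z) g"
    unfolding is_cokernel_iff[OF cz g]
    using ecz desc cmp_zero_left[OF g zo] epi is_epi_iff[OF g] by blast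
  moreover have "is_mono C (ident C c)" unfolding is_mono_iff[OF ic] using cmp_ident_left by auto
  then have "is_kernel C (ident C c) (pzero C c z)"
    unfolding is_kernel_iff[OF ic cz] using cmp_ident_right[OF cz] cmp_ident_left by blast
  ultimately have e3: "exact_at C g (pzero C c z)"
    using cz g unfolding exact_at_def is_image_def by (auto simp: hom_set_def)
  show ?thesis unfolding short_exact_def using z e1 e2 e3 a_def c_def by blast
qed

text \<open>Exactness in the middle only yields a common morphism \<open>m\<close>. A mono of a
  preadditive category may fail to be a kernel, so \<open>f\<close> cannot take the place of
  \<open>m\<close> at this stage; that happens in \<open>short_exact_iff\<close>, where triangles
  exhibit \<open>f\<close> as a kernel.\<close>

lemma short_exactE:
  assumes "short_exact C f g"
  obtains a b c where "f \<in> hom_set C a b" "g \<in> hom_set C b c" "is_mono C f" "is_epi C g"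
    "\<exists>c m. is_cokernel C c f \<and> is_kernel C m c \<and> is_kernel C m g"
proof -
  obtain z where z: "zero_object C z" and e1: "exact_at C (pzero C z (src C f)) f"
    and e2: "exact_at C f g" and e3: "exact_at C g (pzero C (tgt C g) z)"
    using assms unfolding short_exact_def by blast
  define a b c where "a = src C f" and "b = src C g" and "c = tgt C g"
  have f: "f \<in> hom_set C a b" and g: "g \<in> hom_set C b c"
    using e2 by (auto simp: exact_at_def hom_set_def a_def b_def c_def)
  note zo = zero_object_obj[OF z] and a = hom_obj(1)[OF f] and c = hom_obj(2)[OF g]
  note ia = ident_hom[OF a] and ic = ident_hom[OF c]
  have za: "pzero C z a \<in> hom_set C z a" and cz: "pzero C c z \<in> hom_set C c z"
    using zero_hom a c zo by auto
  obtain m1 c1 where m1: "is_cokernel C c1 (pzero C z a)" "is_kernel C m1 c1" "is_kernel C m1 f"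
    using e1 by (auto simp: exact_at_def is_image_def a_def)
  obtain m3 c3 where m3: "is_cokernel C c3 g" "is_kernel C m3 c3" "is_kernel C m3 (pzero C c z)"
    using e3 by (auto simp: exact_at_def is_image_def c_def)
  have "is_mono C f" unfolding is_mono_iff[OF f]
  proof (intro allI ballI impI)
    fix x u assume u: "u \<in> hom_set C x a" "f \<cdot> u = pzero C x b"
    obtain w where m1h: "m1 \<in> hom_set C w a" using m1(3) f is_kernel_hom[of m1 f]
      by (auto simp: hom_set_def)
    obtain v where c1h: "c1 \<in> hom_set C a v" using m1(1) za is_cokernel_hom[of c1 "pzero C z a"]
      by (auto simp: hom_set_def)
    \<comment> \<open>The identity of \<open>a\<close> composes to zero with the arrow from
      \<open>z\<close>, so it factors through the cokernel \<open>c1\<close>. Thus \<open>c1\<close>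
      is split mono, and \<open>c1 \<cdot> m1 = 0\<close> makes the kernel \<open>m1\<close> of
      \<open>f\<close> zero.\<close>
    have "ident C a \<cdot> pzero C z a = pzero C z a" using cmp_ident_left[OF za] .
    then obtain r where r: "r \<in> hom_set C v a" "r \<cdot> c1 = ident C a"
      using m1(1) is_cokernel_iff[OF c1h za] ia by blast
    have c1m1: "c1 \<cdot> m1 = pzero C w v" using m1(2) is_kernel_iff[OF m1h c1h] by blast
    have "m1 = (r \<cdot> c1) \<cdot> m1" using r(2) cmp_ident_left[OF m1h] by simp
    also have "\<dots> = pzero C w a"
      using cmp_assoc[OF m1h c1h r(1)] c1m1 cmp_zero_right[OF r(1)] hom_obj(1)[OF m1h] by simp
    finally have "m1 = pzero C w a" .
    moreover obtain t where "t \<in> hom_set C x w" "m1 \<cdot> t = u"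
      using m1(3) is_kernel_iff[OF m1h f] u by blast
    ultimately show "u = pzero C x a" using cmp_zero_left a by blast
  qed
  moreover have "is_epi C g" unfolding is_epi_iff[OF g]
  proof (intro allI ballI impI)
    fix x u assume u: "u \<in> hom_set C c x" "u \<cdot> g = pzero C b x"
    obtain w where m3h: "m3 \<in> hom_set C w c" using m3(3) cz is_kernel_hom[of m3 "pzero C c z"]
      by (auto simp: hom_set_def)
    obtain v where c3h: "c3 \<in> hom_set C c v" using m3(1) g is_cokernel_hom[of c3 g]
      by (auto simp: hom_set_def)
    \<comment> \<open>Dually, the identity of \<open>c\<close> lifts through the kernel
      \<open>m3\<close>, so \<open>m3\<close> is split epi and the cokernel \<open>c3\<close> of
      \<open>g\<close> is zero.\<close>
    have "pzero C c z \<cdot> ident C c = pzero C c z" using cmp_ident_right[OF cz] .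
    then obtain r where r: "r \<in> hom_set C c w" "m3 \<cdot> r = ident C c"
      using m3(3) is_kernel_iff[OF m3h cz] ic by blast
    have c3m3: "c3 \<cdot> m3 = pzero C w v" using m3(2) is_kernel_iff[OF m3h c3h] by blast
    have "c3 = c3 \<cdot> (m3 \<cdot> r)" using r(2) cmp_ident_right[OF c3h] by simp
    also have "\<dots> = pzero C c v"
      using cmp_assoc[OF r(1) m3h c3h] c3m3 cmp_zero_left[OF r(1)] hom_obj(2)[OF c3h] by simp
    finally have "c3 = pzero C c v" .
    moreover obtain t where "t \<in> hom_set C v x" "t \<cdot> c3 = u"
      using m3(1) is_cokernel_iff[OF c3h g] u by blast
    ultimately show "u = pzero C c x" using cmp_zero_right c by blast
  qed
  moreover have "\<exists>c m. is_cokernel C c f \<and> is_kernel C m c \<and> is_kernel C m g"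
    using e2 by (auto simp: exact_at_def is_image_def)
  ultimately show ?thesis using f g that by blast
qed

end

section \<open>Image factorization in abelian categories\<close>

context abelian_category
begin

text \<open>Here \<open>m\<close> is the kernel of the cokernel of \<open>f\<close>, hence the smallest subobject through which
  \<open>f\<close> factors. So if \<open>s \<cdot> e = 0\<close>, then \<open>m\<close> factors through \<open>m \<cdot> ker s\<close>, which forces \<open>s = 0\<close>; thus
  \<open>e\<close> is epi.\<close>

lemma image_factorization:
  assumes f: "f \<in> hom_set C a b"
  obtains k e m c x i q where "k \<in> hom_set C x a" "e \<in> hom_set C a i" "m \<in> hom_set C i b"
    "c \<in> hom_set C b q" "f = m \<cdot> e" "is_kernel C k e" "is_cokernel C e k"
    "is_kernel C m c" "is_cokernel C c m"
proof -
  have "f \<in> arr C" using f by (simp add: hom_set_def)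
  then obtain c where c0: "is_cokernel C c f" using ex_cokernel by blast
  then obtain q where c: "c \<in> hom_set C b q" using is_cokernel_hom(1)[OF c0] f
    by (auto simp: hom_set_def)
  have "c \<in> arr C" using c by (simp add: hom_set_def)
  then obtain m where m0: "is_kernel C m c" using ex_kernel by blast
  then obtain i where m: "m \<in> hom_set C i b" using is_kernel_hom(1)[OF m0] c
    by (auto simp: hom_set_def)
  have cf: "c \<cdot> f = pzero C a q" and epi_c: "is_epi C c"
    and c_univ: "\<And>y t. t \<in> hom_set C b y \<Longrightarrow> t \<cdot> f = pzero C a y \<Longrightarrow> \<exists>u \<in> hom_set C q y. u \<cdot> c = t"
    using c0 is_cokernel_iff[OF c f] by auto
  have cm: "c \<cdot> m = pzero C i q" and mono_m: "is_mono C m"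
    and m_univ: "\<And>y t. t \<in> hom_set C y b \<Longrightarrow> c \<cdot> t = pzero C y q \<Longrightarrow> \<exists>u \<in> hom_set C y i. m \<cdot> u = t"
    using m0 is_kernel_iff[OF m c] by auto
  obtain e where e: "e \<in> hom_set C a i" and fe: "m \<cdot> e = f" using m_univ f cf by blast
  have "e \<in> arr C" using e by (simp add: hom_set_def)
  then obtain k where k0: "is_kernel C k e" using ex_kernel by blast
  then obtain x where k: "k \<in> hom_set C x a" using is_kernel_hom(1)[OF k0] e
    by (auto simp: hom_set_def)
  have ek: "e \<cdot> k = pzero C x i"
    and k_univ: "\<And>y t. t \<in> hom_set C y a \<Longrightarrow> e \<cdot> t = pzero C y i \<Longrightarrow> \<exists>u \<in> hom_set C y x. k \<cdot> u = t"
    using k0 is_kernel_iff[OF k e] by auto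
  have epi_e: "is_epi C e" unfolding is_epi_iff[OF e]
  proof (intro allI ballI impI)
    fix w s assume s: "s \<in> hom_set C i w" and se: "s \<cdot> e = pzero C a w"
    have "s \<in> arr C" using s by (simp add: hom_set_def)
    then obtain n where n0: "is_kernel C n s" using ex_kernel by blast
    then obtain v where n: "n \<in> hom_set C v i" using is_kernel_hom(1)[OF n0] s
      by (auto simp: hom_set_def)
    have sn: "s \<cdot> n = pzero C v w" and mono_n: "is_mono C n"
      and n_univ: "\<And>y t. t \<in> hom_set C y i \<Longrightarrow> s \<cdot> t = pzero C y w \<Longrightarrow> \<exists>u \<in> hom_set C y v. n \<cdot> u = t"
      using n0 is_kernel_iff[OF n s] by auto
    obtain e' where e': "e' \<in> hom_set C a v" and ne: "n \<cdot> e' = e" using n_univ e se by blast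
    note mn = cmp_hom[OF n m]
    have mono_mn: "is_mono C (m \<cdot> n)" unfolding is_mono_iff[OF mn]
    proof (intro allI ballI impI)
      fix y u assume u: "u \<in> hom_set C y v" and "m \<cdot> n \<cdot> u = pzero C y b"
      then have "n \<cdot> u = pzero C y i"
        using cmp_assoc[OF u n m] mono_m is_mono_iff[OF m] cmp_hom[OF u n] by simp
      then show "u = pzero C y v" using mono_n is_mono_iff[OF n] u by blast
    qed
    \<comment> \<open>Minimality of \<open>m\<close>: since \<open>f\<close> factors through
      \<open>m \<cdot> n\<close>, the arrow \<open>g\<close> kills \<open>f\<close>, so it factors
      through the cokernel \<open>c\<close> and kills \<open>m\<close>; hence \<open>m\<close>
      factors through the kernel \<open>m \<cdot> n\<close> of \<open>g\<close>.\<close>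
    then obtain g where g0: "is_kernel C (m \<cdot> n) g" using mono_is_kernel by blast
    obtain r where g: "g \<in> hom_set C b r" using is_kernel_hom[OF g0] mn by (auto simp: hom_set_def)
    have gmn: "g \<cdot> (m \<cdot> n) = pzero C v r"
      and mn_univ: "\<And>y t. t \<in> hom_set C y b \<Longrightarrow> g \<cdot> t = pzero C y r \<Longrightarrow>
        \<exists>u \<in> hom_set C y v. m \<cdot> n \<cdot> u = t"
      using g0 is_kernel_iff[OF mn g] by auto
    have "f = m \<cdot> n \<cdot> e'" using fe ne cmp_assoc[OF e' n m] by simp
    then have "g \<cdot> f = pzero C a r"
      using cmp_assoc[OF e' mn g] gmn cmp_zero_left[OF e'] hom_obj(2)[OF g] by simp
    then obtain g' where g': "g' \<in> hom_set C q r" "g' \<cdot> c = g" using c_univ g by blast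
    have "g \<cdot> m = pzero C i r"
      using g'(2) cmp_assoc[OF m c g'(1)] cm cmp_zero_right[OF g'(1)] hom_obj(1)[OF m] by simp
    then obtain w' where w': "w' \<in> hom_set C i v" "m \<cdot> n \<cdot> w' = m" using mn_univ m by blast
    have "m \<cdot> (n \<cdot> w') = m \<cdot> ident C i" using w' cmp_assoc[OF w'(1) n m] cmp_ident_right[OF m] by simp
    then have "n \<cdot> w' = ident C i"
      using mono_cancel[OF mono_m m cmp_hom[OF w'(1) n] ident_hom] hom_obj(1)[OF m] by blast
    then have "s = s \<cdot> (n \<cdot> w')" using cmp_ident_right[OF s] by simp
    also have "\<dots> = pzero C i w"
      using cmp_assoc[OF w'(1) n s] sn cmp_zero_left[OF w'(1)] hom_obj(2)[OF s] by simp
    finally show "s = pzero C i w" .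
  qed
  \<comment> \<open>The arrow \<open>g\<close> of which \<open>e\<close> is a cokernel factors
    through \<open>k\<close>, so whatever kills \<open>k\<close> also kills \<open>g\<close>. This
    lets \<open>k\<close> replace \<open>g\<close>.\<close>
  then obtain g where g0: "is_cokernel C e g" using epi_is_cokernel by blast
  obtain w where g: "g \<in> hom_set C w a" using is_cokernel_hom[OF g0] e by (auto simp: hom_set_def)
  have eg: "e \<cdot> g = pzero C w i"
    and e_univ: "\<And>y t. t \<in> hom_set C a y \<Longrightarrow> t \<cdot> g = pzero C w y \<Longrightarrow> \<exists>u \<in> hom_set C i y. u \<cdot> e = t"
    using g0 is_cokernel_iff[OF e g] by auto
  obtain g' where g': "g' \<in> hom_set C w x" "k \<cdot> g' = g" using k_univ[OF g eg] by blast
  have "\<exists>u \<in> hom_set C i y. u \<cdot> e = t" if t: "t \<in> hom_set C a y" "t \<cdot> k = pzero C x y" for y t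
  proof -
    have "t \<cdot> g = pzero C w y"
      using g'(2) cmp_assoc[OF g'(1) k t(1)] t(2) cmp_zero_left[OF g'(1)] hom_obj(2)[OF t(1)] by auto
    then show ?thesis using e_univ[OF t(1)] by blast
  qed
  then have "is_cokernel C e k" using is_cokernel_iff[OF e k] ek epi_e by blast
  moreover have "\<exists>u \<in> hom_set C q y. u \<cdot> c = t" if t: "t \<in> hom_set C b y" "t \<cdot> m = pzero C i y" for y t
  proof -
    have "t \<cdot> f = pzero C a y"
      using fe cmp_assoc[OF e m t(1)] t(2) cmp_zero_left[OF e] hom_obj(2)[OF t(1)] by auto
    then show ?thesis using c_univ[OF t(1)] by blast
  qed
  then have "is_cokernel C c m" using is_cokernel_iff[OF c m] cm epi_c by blast
  ultimately show ?thesis using that k e m c fe[symmetric] k0 m0 by blast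
qed

end

section \<open>Full subcategories\<close>

lemma full_subcategory_sel [simp]:
  "obj (full_subcategory C A) = A"
  "arr (full_subcategory C A) = {f \<in> arr C. src C f \<in> A \<and> tgt C f \<in> A}"
  "src (full_subcategory C A) = src C"
  "tgt (full_subcategory C A) = tgt C"
  "ident (full_subcategory C A) = ident C"
  "cmp (full_subcategory C A) = cmp C"
  by (simp_all add: full_subcategory_def)

lemma full_subcategory_sel_add [simp]:
  "padd (full_subcategory C A) = padd C"
  "pzero (full_subcategory C A) = pzero C"
  by (simp_all add: full_subcategory_def)

lemma hom_set_full_subcategory:
  "hom_set (full_subcategory C A) a b = (if a \<in> A \<and> b \<in> A then hom_set C a b else {})"
  by (auto simp: hom_set_def)

lemma hom_group_full_subcategory:
  "a \<in> A \<Longrightarrow> b \<in> A \<Longrightarrow> hom_group (full_subcategory C A) a b = hom_group C a b"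
  by (simp add: hom_group_def hom_set_full_subcategory)

lemma (in preadditive_category) preadditive_full_subcategory:
  assumes "A \<subseteq> obj C"
  shows "preadditive_category (full_subcategory C A)"
proof -
  have cat: "category (full_subcategory C A)"
  proof (unfold_locales, goal_cases)
    case (3 a) then show ?case using ident_hom assms by (auto simp: hom_set_full_subcategory)
  next
    case (4 f a b g c) then show ?case using cmp_hom[of f a b g c]
      by (auto simp: hom_set_full_subcategory split: if_splits)
  next
    case (5 f a b) then show ?case using cmp_ident_right[of f a b]
      by (auto simp: hom_set_full_subcategory split: if_splits)
  next
    case (6 f a b) then show ?case using cmp_ident_left[of f a b]
      by (auto simp: hom_set_full_subcategory split: if_splits)
  next
    case (7 f a b g c h d) then show ?case using cmp_assoc[of f a b g c h d]
      by (auto simp: hom_set_full_subcategory split: if_splits)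
  qed auto
  show ?thesis
  proof (intro preadditive_category.intro preadditive_category_axioms.intro, goal_cases)
    case 1 show ?case by (rule cat)
  next
    case (2 a b) then show ?case using hom_comm_group assms
      by (auto simp: hom_group_full_subcategory subset_iff)
  next
    case (3 f a b f' g c) then show ?case using cmp_add_left[of f a b f' g c]
      by (auto simp: hom_set_full_subcategory split: if_splits)
  next
    case (4 f a b g c g') then show ?case using cmp_add_right[of f a b g c g']
      by (auto simp: hom_set_full_subcategory split: if_splits)
  qed
qed

text \<open>Closure puts the zero objects and direct sums of \<open>C\<close> into \<open>A\<close>,
  and fullness keeps their structure maps.\<close>

lemma (in additive_category) additive_full_subcategory:
  assumes A: "additive_subcategory C A"
  shows "additive_category (full_subcategory C A)"
proof -
  have sub: "A \<subseteq> obj C" using A by (simp add: additive_subcategory_def)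
  interpret S: preadditive_category "full_subcategory C A"
    by (rule preadditive_full_subcategory[OF sub])
  show ?thesis
  proof (unfold_locales, goal_cases)
    case 1
    obtain z where z: "zero_object C z" using ex_zero_object by blast
    then have "z \<in> A" using A unfolding additive_subcategory_def by blast
    then have "zero_object (full_subcategory C A) z"
      using z sub unfolding zero_object_def by (simp add: hom_set_full_subcategory subset_iff)
    then show ?case by blast
  next
    case (2 a b)
    then obtain s where s: "is_direct_sum C a b s" using ex_direct_sum sub by fastforce
    moreover have "a \<in> A" "b \<in> A" using 2 by simp_all
    ultimately have "s \<in> A" using A unfolding additive_subcategory_def by blast
    then have "is_direct_sum (full_subcategory C A) a b s"
      using s 2 by (simp add: is_direct_sum_def hom_set_full_subcategory)
    then show ?case by blast
  qed
qed

section \<open>Triangulated categories\<close>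

text \<open>Naturality gives \<open>f \<cdot> \<eta> a = g \<cdot> \<eta> a\<close>, and the
  isomorphism \<open>\<eta> a\<close> cancels. The functors stay general so that both suspension and
  desuspension can play \<open>F\<close>.\<close>

lemma (in category) faithful_if_left_quasi_inverse:
  assumes F: "is_functor C F" and nat: "naturally_isomorphic C (comp_endo G F) id_endo"
    and f: "f \<in> hom_set C a b" and g: "g \<in> hom_set C a b" and eq: "on_arr F f = on_arr F g"
  shows "f = g"
proof -
  obtain \<eta> where \<eta>: "\<And>a. a \<in> obj C \<Longrightarrow> \<eta> a \<in> hom_set C (on_obj G (on_obj F a)) a \<and> is_iso C (\<eta> a)"
    and sq: "\<And>f. f \<in> arr C \<Longrightarrow> \<eta> (tgt C f) \<cdot> on_arr G (on_arr F f) = f \<cdot> \<eta> (src C f)"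
    using nat by (auto simp: naturally_isomorphic_def comp_endo_def id_endo_def)
  have eq': "f \<cdot> \<eta> a = g \<cdot> \<eta> a"
    using sq[of f] sq[of g] f g eq by (auto simp: hom_set_def)
  note h = \<eta>[OF hom_obj(1)[OF f]]
  obtain \<theta> where \<theta>: "\<theta> \<in> hom_set C a (on_obj G (on_obj F a))" "\<eta> a \<cdot> \<theta> = ident C a"
    using h is_iso_iff by blast
  have "f = f \<cdot> \<eta> a \<cdot> \<theta>" using cmp_assoc[OF \<theta>(1) conjunct1[OF h] f] \<theta>(2) cmp_ident_right[OF f] by simp
  also have "\<dots> = g" using cmp_assoc[OF \<theta>(1) conjunct1[OF h] g] \<theta>(2) cmp_ident_right[OF g] eq' by simp
  finally show ?thesis .
qed

context triangulated_category
begin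

lemma susp_is_functor: "is_functor C (susp C)"
  using susp_functor by (simp add: is_additive_functor_def)

lemma susp_obj: "a \<in> obj C \<Longrightarrow> \<Sigma>o a \<in> obj C"
  using susp_is_functor by (simp add: is_functor_def)

lemma susp_hom:
  assumes "f \<in> hom_set C a b"
  shows "\<Sigma>a f \<in> hom_set C (\<Sigma>o a) (\<Sigma>o b)"
  using susp_is_functor assms hom_obj[OF assms] unfolding is_functor_def by blast

lemma susp_ident: "a \<in> obj C \<Longrightarrow> \<Sigma>a (ident C a) = ident C (\<Sigma>o a)"
  using susp_is_functor by (simp add: is_functor_def)

lemma susp_cmp:
  assumes "f \<in> hom_set C a b" "g \<in> hom_set C b c"
  shows "\<Sigma>a (g \<cdot> f) = \<Sigma>a g \<cdot> \<Sigma>a f"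
  using susp_is_functor assms by (simp add: is_functor_def hom_set_def)

lemma susp_add:
  assumes "f \<in> hom_set C a b" "g \<in> hom_set C a b"
  shows "\<Sigma>a (f \<^bold>+ g) = \<Sigma>a f \<^bold>+ \<Sigma>a g"
  using susp_functor assms hom_obj[OF assms(1)] unfolding is_additive_functor_def by blast

lemma susp_zero:
  assumes "a \<in> obj C" "b \<in> obj C"
  shows "\<Sigma>a (pzero C a b) = pzero C (\<Sigma>o a) (\<Sigma>o b)"
  using add_idem_zero[OF susp_hom[OF zero_hom[OF assms]]]
    susp_add[OF zero_hom[OF assms] zero_hom[OF assms]] add_zero[OF zero_hom[OF assms]] by simp

lemma susp_neg:
  assumes "f \<in> hom_set C a b"
  shows "\<Sigma>a (pneg C f) = pneg C (\<Sigma>a f)"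
  using neg_unique[OF susp_hom[OF assms] susp_hom[OF neg_hom[OF assms]]]
    susp_add[OF assms neg_hom[OF assms]] add_neg[OF assms] susp_zero[OF hom_obj[OF assms]] by simp

lemma susp_zero_object:
  assumes "zero_object C z"
  shows "zero_object C (\<Sigma>o z)"
proof (rule zero_objectI)
  note z = zero_object_obj[OF assms]
  show "\<Sigma>o z \<in> obj C" using susp_obj[OF z] .
  show "ident C (\<Sigma>o z) = pzero C (\<Sigma>o z) (\<Sigma>o z)"
    using susp_ident[OF z] to_zero_object[OF assms ident_hom[OF z]] susp_zero[OF z z] by simp
qed

lemma desusp_obj: "a \<in> obj C \<Longrightarrow> desusp_obj C a \<in> obj C"
  using desusp_functor by (simp add: is_functor_def)

lemma desusp_hom:
  assumes "f \<in> hom_set C a b"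
  shows "on_arr (desusp C) f \<in> hom_set C (desusp_obj C a) (desusp_obj C b)"
  using desusp_functor assms hom_obj[OF assms] unfolding is_functor_def by blast

lemmas susp_faithful = faithful_if_left_quasi_inverse[OF susp_is_functor desusp_susp]
lemmas desusp_faithful = faithful_if_left_quasi_inverse[OF desusp_functor susp_desusp]

lemma unit_iso:
  obtains \<eta> \<theta> where
    "\<And>a. a \<in> obj C \<Longrightarrow> \<eta> a \<in> hom_set C (desusp_obj C (\<Sigma>o a)) a"
    "\<And>a. a \<in> obj C \<Longrightarrow> \<theta> a \<in> hom_set C a (desusp_obj C (\<Sigma>o a))"
    "\<And>a. a \<in> obj C \<Longrightarrow> \<theta> a \<cdot> \<eta> a = ident C (desusp_obj C (\<Sigma>o a))"
    "\<And>a. a \<in> obj C \<Longrightarrow> \<eta> a \<cdot> \<theta> a = ident C a"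
    "\<And>a b f. f \<in> hom_set C a b \<Longrightarrow> \<eta> b \<cdot> on_arr (desusp C) (\<Sigma>a f) = f \<cdot> \<eta> a"
proof -
  obtain \<eta> where \<eta>: "\<And>a. a \<in> obj C \<Longrightarrow> \<eta> a \<in> hom_set C (desusp_obj C (\<Sigma>o a)) a \<and> is_iso C (\<eta> a)"
    and sq: "\<And>f. f \<in> arr C \<Longrightarrow> \<eta> (tgt C f) \<cdot> on_arr (desusp C) (\<Sigma>a f) = f \<cdot> \<eta> (src C f)"
    using desusp_susp by (auto simp: naturally_isomorphic_def comp_endo_def id_endo_def)
  have "\<forall>a. \<exists>t. a \<in> obj C \<longrightarrow> t \<in> hom_set C a (desusp_obj C (\<Sigma>o a)) \<and>
      t \<cdot> \<eta> a = ident C (desusp_obj C (\<Sigma>o a)) \<and> \<eta> a \<cdot> t = ident C a"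
    using \<eta> is_iso_iff by blast
  then obtain \<theta> where \<theta>: "\<And>a. a \<in> obj C \<Longrightarrow> \<theta> a \<in> hom_set C a (desusp_obj C (\<Sigma>o a)) \<and>
      \<theta> a \<cdot> \<eta> a = ident C (desusp_obj C (\<Sigma>o a)) \<and> \<eta> a \<cdot> \<theta> a = ident C a"
    by metis
  show ?thesis
  proof (rule that[of \<eta> \<theta>])
    fix a b f assume "f \<in> hom_set C a b"
    then show "\<eta> b \<cdot> on_arr (desusp C) (\<Sigma>a f) = f \<cdot> \<eta> a" using sq[of f] by (auto simp: hom_set_def)
  qed (use \<eta> \<theta> in auto)
qed

text \<open>Conjugating the desuspension of \<open>g\<close> by the natural isomorphism gives
  \<open>f\<close>. Then \<open>\<Sigma>a f\<close> and \<open>g\<close> have the same desuspension,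
  and desuspension is faithful.\<close>

lemma susp_full:
  assumes g: "g \<in> hom_set C (\<Sigma>o a) (\<Sigma>o b)" and a: "a \<in> obj C" and b: "b \<in> obj C"
  obtains f where "f \<in> hom_set C a b" "\<Sigma>a f = g"
proof -
  obtain \<eta> \<theta> where \<eta>: "\<And>a. a \<in> obj C \<Longrightarrow> \<eta> a \<in> hom_set C (desusp_obj C (\<Sigma>o a)) a"
    and \<theta>: "\<And>a. a \<in> obj C \<Longrightarrow> \<theta> a \<in> hom_set C a (desusp_obj C (\<Sigma>o a))"
    and inv: "\<And>a. a \<in> obj C \<Longrightarrow> \<theta> a \<cdot> \<eta> a = ident C (desusp_obj C (\<Sigma>o a))"
    and sq: "\<And>a b f. f \<in> hom_set C a b \<Longrightarrow> \<eta> b \<cdot> on_arr (desusp C) (\<Sigma>a f) = f \<cdot> \<eta> a"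
    by (rule unit_iso) (rule that)
  define f where "f = \<eta> b \<cdot> on_arr (desusp C) g \<cdot> \<theta> a"
  note dg = desusp_hom[OF g]
  note \<eta>g = cmp_hom[OF dg \<eta>[OF b]]
  have f: "f \<in> hom_set C a b" unfolding f_def using cmp_hom[OF \<theta>[OF a] \<eta>g] .
  note df = desusp_hom[OF susp_hom[OF f]]
  have "f \<cdot> \<eta> a = \<eta> b \<cdot> on_arr (desusp C) g"
    unfolding f_def using cmp_assoc[OF \<eta>[OF a] \<theta>[OF a] \<eta>g] inv[OF a] cmp_ident_right[OF \<eta>g] by simp
  then have "\<theta> b \<cdot> (\<eta> b \<cdot> on_arr (desusp C) (\<Sigma>a f)) = \<theta> b \<cdot> (\<eta> b \<cdot> on_arr (desusp C) g)"
    using sq[OF f] by simp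
  then have "on_arr (desusp C) (\<Sigma>a f) = on_arr (desusp C) g"
    using cmp_assoc[OF df \<eta>[OF b] \<theta>[OF b]] cmp_assoc[OF dg \<eta>[OF b] \<theta>[OF b]] inv[OF b]
      cmp_ident_left[OF df] cmp_ident_left[OF dg] by simp
  then show ?thesis using desusp_faithful[OF susp_hom[OF f] g] f that by blast
qed

text \<open>One half of the adjunction between suspension and desuspension: sending \<open>f\<close>
  to its desuspension composed with \<open>\<theta> a\<close> is injective, and its values lie in a
  hom set with a single element.\<close>

lemma hom_vanishes_susp:
  assumes hv: "hom_set C a (desusp_obj C b) = {pzero C a (desusp_obj C b)}"
    and a: "a \<in> obj C" and b: "b \<in> obj C"
  shows "hom_set C (\<Sigma>o a) b = {pzero C (\<Sigma>o a) b}"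
proof -
  have "f = g" if f: "f \<in> hom_set C (\<Sigma>o a) b" and g: "g \<in> hom_set C (\<Sigma>o a) b" for f g
  proof -
    obtain \<eta> \<theta> where \<eta>: "\<And>a. a \<in> obj C \<Longrightarrow> \<eta> a \<in> hom_set C (desusp_obj C (\<Sigma>o a)) a"
      and \<theta>: "\<And>a. a \<in> obj C \<Longrightarrow> \<theta> a \<in> hom_set C a (desusp_obj C (\<Sigma>o a))"
      and inv: "\<And>a. a \<in> obj C \<Longrightarrow> \<theta> a \<cdot> \<eta> a = ident C (desusp_obj C (\<Sigma>o a))"
      by (rule unit_iso) (rule that)
    note df = desusp_hom[OF f] and dg = desusp_hom[OF g]
    have "on_arr (desusp C) f \<cdot> \<theta> a = on_arr (desusp C) g \<cdot> \<theta> a"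
      using cmp_hom[OF \<theta>[OF a] df] cmp_hom[OF \<theta>[OF a] dg] hv by auto
    then have "on_arr (desusp C) f \<cdot> \<theta> a \<cdot> \<eta> a = on_arr (desusp C) g \<cdot> \<theta> a \<cdot> \<eta> a" by simp
    then have "on_arr (desusp C) f = on_arr (desusp C) g"
      using cmp_assoc[OF \<eta>[OF a] \<theta>[OF a] df] cmp_assoc[OF \<eta>[OF a] \<theta>[OF a] dg] inv[OF a]
        cmp_ident_right[OF df] cmp_ident_right[OF dg] by simp
    then show ?thesis using desusp_faithful[OF f g] by blast
  qed
  then show ?thesis using zero_hom[OF susp_obj[OF a] b] by blast
qed

section \<open>Triangles as sequences of weak kernels and weak cokernels\<close>

text \<open>Elements of \<open>tri C\<close> record arrows only; here the three objects travel
  along, so that hom set memberships need not be recovered each time.\<close>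

definition triangle :: "'o \<Rightarrow> 'o \<Rightarrow> 'o \<Rightarrow> 'm \<Rightarrow> 'm \<Rightarrow> 'm \<Rightarrow> bool" where
  "triangle x y z f g h \<longleftrightarrow>
    f \<in> hom_set C x y \<and> g \<in> hom_set C y z \<and> h \<in> hom_set C z (\<Sigma>o x) \<and> (f, g, h) \<in> tri C"

lemma triangleD:
  assumes "triangle x y z f g h"
  shows "f \<in> hom_set C x y" "g \<in> hom_set C y z" "h \<in> hom_set C z (\<Sigma>o x)" "(f, g, h) \<in> tri C"
  using assms by (auto simp: triangle_def)

lemma short_triangleE:
  assumes "short_triangle C f g" "f \<in> hom_set C x y" "g \<in> hom_set C y z"
  obtains h where "triangle x y z f g h"
proof -
  obtain h where h: "(f, g, h) \<in> tri C" using assms(1) by (auto simp: short_triangle_def)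
  obtain x' y' z' where "f \<in> hom_set C x' y'" "g \<in> hom_set C y' z'" "h \<in> hom_set C z' (\<Sigma>o x')"
    using tri_shape[OF h] by blast
  then show ?thesis using that[of h] h assms(2,3) by (auto simp: triangle_def hom_set_def)
qed

lemma cone_exists:
  assumes "f \<in> hom_set C x y"
  obtains z g h where "triangle x y z f g h"
proof -
  have "f \<in> arr C" using assms by (simp add: hom_set_def)
  then obtain g h where gh: "(f, g, h) \<in> tri C" using TR1_complete by blast
  obtain x' y' z' where "f \<in> hom_set C x' y'" "g \<in> hom_set C y' z'" "h \<in> hom_set C z' (\<Sigma>o x')"
    using tri_shape[OF gh] by blast
  then show ?thesis using that[of z' g h] gh assms by (auto simp: triangle_def hom_set_def)
qed

lemma triangle_rotate:
  assumes "triangle x y z f g h"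
  shows "triangle y z (\<Sigma>o x) g h (pneg C (\<Sigma>a f))"
  using triangleD[OF assms] TR2 neg_hom[OF susp_hom[OF triangleD(1)[OF assms]]]
  by (simp add: triangle_def)

lemma triangle_ident:
  assumes "x \<in> obj C" "zero_object C z"
  shows "triangle x x z (ident C x) (pzero C x z) (pzero C z (\<Sigma>o x))"
  using TR1_ident[OF assms] assms(1) zero_object_obj[OF assms(2)] ident_hom zero_hom susp_obj
  by (simp add: triangle_def)

text \<open>Rotate back the identity triangle of \<open>x\<close> that ends in the zero object
  \<open>\<Sigma>o z\<close>.\<close>

lemma triangle_zero_ident:
  assumes x: "x \<in> obj C" and z: "zero_object C z"
  shows "triangle z x x (pzero C z x) (ident C x) (pzero C x (\<Sigma>o z))"
proof -
  note zo = zero_object_obj[OF z]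
  have "pneg C (\<Sigma>a (pzero C z x)) = pzero C (\<Sigma>o z) (\<Sigma>o x)"
    using susp_zero[OF zo x] neg_zero susp_obj[OF zo] susp_obj[OF x] by simp
  then show ?thesis
    using triangleD[OF triangle_ident[OF x susp_zero_object[OF z]]] TR2 zero_hom[OF zo x]
    by (simp add: triangle_def)
qed

text \<open>TR3 extends \<open>u\<close>, together with a zero map on \<open>x\<close>, to a
  morphism into the triangle \<open>0 -> w = w\<close>; its third component is the
  factorization.\<close>

lemma triangle_weak_cokernel:
  assumes T: "triangle x y z f g h" and u: "u \<in> hom_set C y w" "u \<cdot> f = pzero C x w"
  shows "\<exists>v \<in> hom_set C z w. v \<cdot> g = u"
proof -
  obtain o0 where o0: "zero_object C o0" using ex_zero_object by blast
  note w = hom_obj(2)[OF u(1)] and x = hom_obj(1)[OF triangleD(1)[OF T]]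
  note T0 = triangle_zero_ident[OF w o0]
  note xo = zero_hom[OF x zero_object_obj[OF o0]]
  have "u \<cdot> f = pzero C o0 w \<cdot> pzero C x o0" using u(2) cmp_zero_left[OF xo w] by simp
  from TR3[OF triangleD(4)[OF T] triangleD(4)[OF T0] triangleD(1-3)[OF T] triangleD(1-3)[OF T0]
      xo u(1) this]
  show ?thesis using cmp_ident_left[OF u(1)] by auto
qed

text \<open>TR3 fills in the third map from the rotated identity triangle of \<open>w\<close> to the
  rotated given triangle. That map goes from \<open>\<Sigma>o w\<close> to
  \<open>\<Sigma>o x\<close>, so fullness of the suspension brings it down to
  \<open>v\<close>.\<close>

lemma triangle_weak_kernel:
  assumes T: "triangle x y z f g h" and u: "u \<in> hom_set C w y" "g \<cdot> u = pzero C w z"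
  shows "\<exists>v \<in> hom_set C w x. f \<cdot> v = u"
proof -
  obtain o0 where o0: "zero_object C o0" using ex_zero_object by blast
  note w = hom_obj(1)[OF u(1)] and x = hom_obj(1)[OF triangleD(1)[OF T]]
    and z = hom_obj(2)[OF triangleD(2)[OF T]]
  note oz = zero_hom[OF zero_object_obj[OF o0] z]
  note T0 = triangle_rotate[OF triangle_ident[OF w o0]]
  note T1 = triangle_rotate[OF T]
  have "pzero C o0 z \<cdot> pzero C w o0 = g \<cdot> u"
    using u(2) cmp_zero_left[OF zero_hom[OF w zero_object_obj[OF o0]] z] by simp
  from TR3[OF triangleD(4)[OF T0] triangleD(4)[OF T1] triangleD(1-3)[OF T0] triangleD(1-3)[OF T1]
      u(1) oz this]
  obtain v' where v': "v' \<in> hom_set C (\<Sigma>o w) (\<Sigma>o x)"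
    "\<Sigma>a u \<cdot> pneg C (\<Sigma>a (ident C w)) = pneg C (\<Sigma>a f) \<cdot> v'" by blast
  obtain v where v: "v \<in> hom_set C w x" "\<Sigma>a v = v'" using susp_full[OF v'(1) w x] by blast
  note f = triangleD(1)[OF T] and iw = ident_hom[OF w]
  \<comment> \<open>Both rotations introduced a sign; the two signs cancel.\<close>
  have "pneg C (\<Sigma>a u) = \<Sigma>a u \<cdot> pneg C (\<Sigma>a (ident C w))"
    using cmp_neg_right[OF susp_hom[OF iw] susp_hom[OF u(1)]] susp_cmp[OF iw u(1)]
      cmp_ident_right[OF u(1)] by simp
  also have "\<dots> = pneg C (\<Sigma>a (f \<cdot> v))"
    using v'(2) v(2) cmp_neg_left[OF v'(1) susp_hom[OF f]] susp_cmp[OF v(1) f] by simp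
  finally have "\<Sigma>a u = \<Sigma>a (f \<cdot> v)"
    using neg_neg[OF susp_hom[OF u(1)]] neg_neg[OF susp_hom[OF cmp_hom[OF v(1) f]]] by metis
  then show ?thesis using susp_faithful[OF u(1) cmp_hom[OF v(1) f]] v(1) by blast
qed

lemmas triangle_weak_cokernel2 = triangle_weak_cokernel[OF triangle_rotate]
lemmas triangle_weak_kernel2 = triangle_weak_kernel[OF triangle_rotate]

text \<open>Rotating twice turns \<open>h\<close> into a weak kernel of the negative of
  \<open>\<Sigma>a f\<close>; the sign does not affect which arrows are killed.\<close>

lemma triangle_weak_kernel3:
  assumes T: "triangle x y z f g h" and u: "u \<in> hom_set C w (\<Sigma>o x)" "\<Sigma>a f \<cdot> u = pzero C w (\<Sigma>o y)"
  shows "\<exists>v \<in> hom_set C w z. h \<cdot> v = u"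
proof -
  note y = hom_obj(2)[OF triangleD(1)[OF T]]
  have "pneg C (\<Sigma>a f) \<cdot> u = pzero C w (\<Sigma>o y)"
    using cmp_neg_left[OF u(1) susp_hom[OF triangleD(1)[OF T]]] u(2)
      neg_zero[OF hom_obj(1)[OF u(1)] susp_obj[OF y]] by simp
  then show ?thesis using triangle_weak_kernel2[OF triangle_rotate[OF T] u(1)] by blast
qed

text \<open>By TR3, the pair of \<open>ident C x\<close> and \<open>f\<close> extends to a map from
  the identity triangle of \<open>x\<close>, so \<open>g \<cdot> f\<close> factors through a zero
  object.\<close>

lemma triangle_cmp_zero:
  assumes T: "triangle x y z f g h"
  shows "g \<cdot> f = pzero C x z"
proof -
  obtain o0 where o0: "zero_object C o0" using ex_zero_object by blast
  note x = hom_obj(1)[OF triangleD(1)[OF T]] and f = triangleD(1)[OF T] and g = triangleD(2)[OF T]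
  note T0 = triangle_ident[OF x o0]
  have "f \<cdot> ident C x = f \<cdot> ident C x" ..
  from TR3[OF triangleD(4)[OF T0] triangleD(4)[OF T] triangleD(1-3)[OF T0] triangleD(1-3)[OF T]
      ident_hom[OF x] f this]
  obtain v where "v \<in> hom_set C o0 z" "v \<cdot> pzero C x o0 = g \<cdot> f" by blast
  then show ?thesis using cmp_zero_right x by metis
qed

lemma triangle_cmp_zero3:
  assumes T: "triangle x y z f g h"
  shows "\<Sigma>a f \<cdot> h = pzero C z (\<Sigma>o y)"
proof -
  note f = susp_hom[OF triangleD(1)[OF T]] and h = triangleD(3)[OF T]
  have "pneg C (\<Sigma>a f \<cdot> h) = pzero C z (\<Sigma>o y)"
    using triangle_cmp_zero[OF triangle_rotate[OF triangle_rotate[OF T]]] cmp_neg_left[OF h f] by simp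
  then show ?thesis using neg_eq_zero[OF cmp_hom[OF h f]] by simp
qed

text \<open>If \<open>f\<close> kills \<open>u\<close>, then \<open>\<Sigma>a u\<close> factors
  through the zero third arrow, and the suspension is faithful.\<close>

lemma triangle_mono:
  assumes T: "triangle x y z f g (pzero C z (\<Sigma>o x))"
  shows "is_mono C f"
  unfolding is_mono_iff[OF triangleD(1)[OF T]]
proof (intro allI ballI impI)
  fix w u assume u: "u \<in> hom_set C w x" "f \<cdot> u = pzero C w y"
  note o = hom_obj[OF u(1)] hom_obj[OF triangleD(2)[OF T]]
  have "\<Sigma>a f \<cdot> \<Sigma>a u = pzero C (\<Sigma>o w) (\<Sigma>o y)"
    using susp_cmp[OF u(1) triangleD(1)[OF T]] u(2) susp_zero[OF o(1,3)] by simp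
  then obtain v where "v \<in> hom_set C (\<Sigma>o w) z" "pzero C z (\<Sigma>o x) \<cdot> v = \<Sigma>a u"
    using triangle_weak_kernel3[OF T susp_hom[OF u(1)]] by blast
  then have "\<Sigma>a u = \<Sigma>a (pzero C w x)" using cmp_zero_left susp_obj[OF o(2)] susp_zero[OF o(1,2)] by metis
  then show "u = pzero C w x" using susp_faithful[OF u(1) zero_hom[OF o(1,2)]] by blast
qed

lemma triangle_epi:
  assumes T: "triangle x y z f g (pzero C z (\<Sigma>o x))"
  shows "is_epi C g"
  unfolding is_epi_iff[OF triangleD(2)[OF T]]
proof (intro allI ballI impI)
  fix w u assume u: "u \<in> hom_set C z w" "u \<cdot> g = pzero C y w"
  then obtain v where "v \<in> hom_set C (\<Sigma>o x) w" "v \<cdot> pzero C z (\<Sigma>o x) = u"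
    using triangle_weak_cokernel2[OF T u] by blast
  then show "u = pzero C z w" using cmp_zero_right hom_obj(1)[OF u(1)] by metis
qed

end

section \<open>Proper abelian subcategories\<close>

context triangulated_category
begin

text \<open>A morphism pair that is a kernel and a cokernel of each other is short exact, which
  properness converts to a triangle. This serves both halves of an epi-mono factorization.\<close>

lemma proper_abelian_triangle:
  assumes P: "proper_abelian_subcategory C A"
    and ker: "is_kernel (full_subcategory C A) k e" and coker: "is_cokernel (full_subcategory C A) e k"
    and k: "k \<in> hom_set C x a" and e: "e \<in> hom_set C a i"
  obtains n where "triangle x a i k e n"
proof -
  interpret B: abelian_category "full_subcategory C A"
    using P by (simp add: proper_abelian_subcategory_def)
  obtain z where "zero_object (full_subcategory C A) z" using B.ex_zero_object by blast
  then have "short_exact (full_subcategory C A) k e" using B.short_exactI[OF ker coker] by blast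
  moreover have "k \<in> arr C" "e \<in> arr C" using k e by (auto simp: hom_set_def)
  ultimately have "short_triangle C k e" using P unfolding proper_abelian_subcategory_def by blast
  from short_triangleE[OF this k e] show ?thesis using that by blast
qed

lemma star_subset_if_proper_abelian:
  assumes P: "proper_abelian_subcategory C A"
  shows "star C A (\<Sigma>o ` A) \<subseteq> star C (\<Sigma>o ` A) A"
proof
  fix c assume "c \<in> star C A (\<Sigma>o ` A)"
  then obtain b a p h where c: "c \<in> obj C" and b: "b \<in> A" and a: "a \<in> A"
    and p: "p \<in> hom_set C b c" and h: "h \<in> hom_set C c (\<Sigma>o a)" and "short_triangle C p h"
    unfolding star_def by blast
  then obtain \<delta> where T: "triangle b c (\<Sigma>o a) p h \<delta>" using short_triangleE by blast
  interpret B: abelian_category "full_subcategory C A"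
    using P by (simp add: proper_abelian_subcategory_def)
  have sub: "A \<subseteq> obj C"
    using P by (simp add: proper_abelian_subcategory_def additive_subcategory_def)
  note \<delta> = triangleD(3)[OF T]
  have "a \<in> obj C" "b \<in> obj C" using a b sub by auto
  \<comment> \<open>The morphism with cone \<open>c\<close>: the connecting arrow
    \<open>\<delta>\<close> is desuspended with opposite sign, since TR2 negates
    \<open>\<Sigma>a f\<close>.\<close>
  then obtain f where f: "f \<in> hom_set C a b" "\<Sigma>a f = pneg C \<delta>"
    using susp_full[OF neg_hom[OF \<delta>]] by blast
  have "pneg C (\<Sigma>a f) = \<delta>" using f(2) neg_neg[OF \<delta>] by simp
  then have Tf: "triangle a b c f p h"
    using triangleD[OF T] f(1) TR2[OF f(1) p h] by (simp add: triangle_def)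
  have "f \<in> hom_set (full_subcategory C A) a b" using f(1) a b by (simp add: hom_set_full_subcategory)
  then obtain k e m d x i q where fac: "k \<in> hom_set (full_subcategory C A) x a"
    "e \<in> hom_set (full_subcategory C A) a i" "m \<in> hom_set (full_subcategory C A) i b"
    "d \<in> hom_set (full_subcategory C A) b q" "f = m \<cdot>\<^bsub>full_subcategory C A\<^esub> e"
    and ke: "is_kernel (full_subcategory C A) k e" "is_cokernel (full_subcategory C A) e k"
    and md: "is_kernel (full_subcategory C A) m d" "is_cokernel (full_subcategory C A) d m"
    by (rule B.image_factorization) (rule that)
  have A: "x \<in> A" "i \<in> A" "q \<in> A" using B.hom_obj[OF fac(1)] B.hom_obj[OF fac(3)] B.hom_obj[OF fac(4)]
    by auto
  have k: "k \<in> hom_set C x a" and e: "e \<in> hom_set C a i" and m: "m \<in> hom_set C i b"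
    and d: "d \<in> hom_set C b q" and fme: "f = m \<cdot> e"
    using fac A a b by (auto simp: hom_set_full_subcategory)
  obtain n where "triangle x a i k e n" using proper_abelian_triangle[OF P ke k e] .
  \<comment> \<open>After rotation \<open>e\<close> has cone \<open>\<Sigma>o x\<close>, while
    \<open>m\<close> has cone \<open>q\<close>. The octahedron over \<open>f = m \<cdot> e\<close>
    then places \<open>c\<close> between these two.\<close>
  note T1 = triangle_rotate[OF this]
  obtain n' where T2: "triangle i b q m d n'" using proper_abelian_triangle[OF P md m d] .
  have "(m \<cdot> e, p, h) \<in> tri C" using triangleD(4)[OF Tf] fme by simp
  from TR4[OF triangleD(4)[OF T1] triangleD(4)[OF T2] this e m triangleD(2,3)[OF T1]
      triangleD(2,3)[OF T2] p h]
  obtain s t where "s \<in> hom_set C (\<Sigma>o x) c" "t \<in> hom_set C c q" "short_triangle C s t"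
    unfolding short_triangle_def by blast
  then show "c \<in> star C (\<Sigma>o ` A) A" unfolding star_def using A c by blast
qed

end

section \<open>Kernels and cokernels obtained from vanishing\<close>

text \<open>The vanishing of \<open>condition_E2\<close> is moved to the source side, since the
  obstructions met in triangles are morphisms out of suspensions.\<close>

locale vanishing_subcategory = triangulated_category C
  for C :: "('o, 'm, 'x) tricat_scheme" (structure) +
  fixes A :: "'o set"
  assumes additive: "additive_subcategory C A"
    and hom_susp_zero: "a \<in> A \<Longrightarrow> b \<in> A \<Longrightarrow> f \<in> hom_set C (\<Sigma>o a) b \<Longrightarrow> f = pzero C (\<Sigma>o a) b"
    and hom_susp_susp_zero: "a \<in> A \<Longrightarrow> b \<in> A \<Longrightarrow> f \<in> hom_set C (\<Sigma>o (\<Sigma>o a)) b \<Longrightarrow>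
      f = pzero C (\<Sigma>o (\<Sigma>o a)) b"
begin

abbreviation "B \<equiv> full_subcategory C A"

interpretation B: additive_category B
  by (rule additive_full_subcategory[OF additive])

lemma A_obj: "a \<in> A \<Longrightarrow> a \<in> obj C"
  using additive unfolding additive_subcategory_def by blast

lemma hom_set_B: "a \<in> A \<Longrightarrow> b \<in> A \<Longrightarrow> hom_set B a b = hom_set C a b"
  by (simp add: hom_set_full_subcategory)

text \<open>This and the next three characterizations express notions of \<open>B\<close> through
  hom sets of \<open>C\<close>, tested on objects of \<open>A\<close> only, so that triangles of
  \<open>C\<close> can be applied.\<close>

lemma is_mono_B_iff:
  assumes "f \<in> hom_set C a b" "a \<in> A" "b \<in> A"
  shows "is_mono B f \<longleftrightarrow> (\<forall>x \<in> A. \<forall>u \<in> hom_set C x a. f \<cdot> u = pzero C x b \<longrightarrow> u = pzero C x a)"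
proof -
  have "f \<in> hom_set B a b" using assms hom_set_B by simp
  from B.is_mono_iff[OF this] show ?thesis using assms(2) by (simp add: hom_set_full_subcategory Ball_def)
qed

lemma is_epi_B_iff:
  assumes "f \<in> hom_set C a b" "a \<in> A" "b \<in> A"
  shows "is_epi B f \<longleftrightarrow> (\<forall>x \<in> A. \<forall>u \<in> hom_set C b x. u \<cdot> f = pzero C a x \<longrightarrow> u = pzero C b x)"
proof -
  have "f \<in> hom_set B a b" using assms hom_set_B by simp
  from B.is_epi_iff[OF this] show ?thesis using assms(3) by (simp add: hom_set_full_subcategory Ball_def)
qed

lemma is_kernel_B_iff:
  assumes "k \<in> hom_set C x a" "f \<in> hom_set C a b" "x \<in> A" "a \<in> A" "b \<in> A"
  shows "is_kernel B k f \<longleftrightarrow> f \<cdot> k = pzero C x b \<and> is_mono B k \<and>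
    (\<forall>y \<in> A. \<forall>t \<in> hom_set C y a. f \<cdot> t = pzero C y b \<longrightarrow> (\<exists>u \<in> hom_set C y x. k \<cdot> u = t))"
proof -
  have "k \<in> hom_set B x a" "f \<in> hom_set B a b" using assms hom_set_B by simp_all
  from B.is_kernel_iff[OF this] show ?thesis
    using assms(3,4) by (simp add: hom_set_full_subcategory Ball_def)
qed

lemma is_cokernel_B_iff:
  assumes "c \<in> hom_set C b x" "f \<in> hom_set C a b" "x \<in> A" "a \<in> A" "b \<in> A"
  shows "is_cokernel B c f \<longleftrightarrow> c \<cdot> f = pzero C a x \<and> is_epi B c \<and>
    (\<forall>y \<in> A. \<forall>t \<in> hom_set C b y. t \<cdot> f = pzero C a y \<longrightarrow> (\<exists>u \<in> hom_set C x y. u \<cdot> c = t))"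
proof -
  have "c \<in> hom_set B b x" "f \<in> hom_set B a b" using assms hom_set_B by simp_all
  from B.is_cokernel_iff[OF this] show ?thesis
    using assms(3,5) by (simp add: hom_set_full_subcategory Ball_def)
qed

text \<open>Existence of factorizations holds in every triangle. The obstructions to uniqueness are
  morphisms from \<open>\<Sigma>o x\<close> to \<open>c\<close> for the kernel and from
  \<open>\<Sigma>o a\<close> to \<open>x\<close> for the cokernel, and both vanish.\<close>

lemma triangle_kernel_cokernel:
  assumes T: "triangle a b c f g h" and A: "a \<in> A" "b \<in> A" "c \<in> A"
  shows "is_kernel B f g" "is_cokernel B g f"
proof -
  note f = triangleD(1)[OF T] and g = triangleD(2)[OF T] and h = triangleD(3)[OF T]
  have "u = pzero C x a" if x: "x \<in> A" and u: "u \<in> hom_set C x a" "f \<cdot> u = pzero C x b" for x u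
  proof -
    note o = A_obj[OF x] A_obj[OF A(1)]
    have "\<Sigma>a f \<cdot> \<Sigma>a u = pzero C (\<Sigma>o x) (\<Sigma>o b)"
      using susp_cmp[OF u(1) f] u(2) susp_zero[OF o(1) A_obj[OF A(2)]] by simp
    then obtain w where w: "w \<in> hom_set C (\<Sigma>o x) c" "h \<cdot> w = \<Sigma>a u"
      using triangle_weak_kernel3[OF T susp_hom[OF u(1)]] by blast
    then have "\<Sigma>a u = \<Sigma>a (pzero C x a)"
      using hom_susp_zero[OF x A(3) w(1)] cmp_zero_right[OF h susp_obj[OF o(1)]] susp_zero[OF o] by simp
    then show ?thesis using susp_faithful[OF u(1) zero_hom[OF o]] by blast
  qed
  then have "is_mono B f" using is_mono_B_iff[OF f A(1,2)] by blast
  then show "is_kernel B f g"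
    using is_kernel_B_iff[OF f g A] triangle_cmp_zero[OF T] triangle_weak_kernel[OF T] by blast
  have "u = pzero C c x" if x: "x \<in> A" and u: "u \<in> hom_set C c x" "u \<cdot> g = pzero C b x" for x u
  proof -
    obtain w where w: "w \<in> hom_set C (\<Sigma>o a) x" "w \<cdot> h = u"
      using triangle_weak_cokernel2[OF T u] by blast
    then show ?thesis using hom_susp_zero[OF A(1) x w(1)] cmp_zero_left[OF h A_obj[OF x]] by simp
  qed
  then have "is_epi B g" using is_epi_B_iff[OF g A(2,3)] by blast
  then show "is_cokernel B g f"
    using is_cokernel_B_iff[OF g f A(3,1,2)] triangle_cmp_zero[OF T] triangle_weak_cokernel[OF T]
    by blast
qed

text \<open>Each claim is a chase through \<open>T\<close> and \<open>D\<close> in turn. Existence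
  uses the vanishing out of single suspensions; uniqueness also uses the one out of double
  suspensions.\<close>

lemma cone_extension_kernel_cokernel:
  assumes T: "triangle a b c f g h" and D: "triangle (\<Sigma>o k) c q s t r"
    and A: "a \<in> A" "b \<in> A" "k \<in> A" "q \<in> A"
    and \<kappa>: "\<kappa> \<in> hom_set C k a" "\<Sigma>a \<kappa> = h \<cdot> s"
  shows "is_kernel B \<kappa> f" "is_cokernel B (t \<cdot> g) f"
proof -
  note f = triangleD(1)[OF T] and g = triangleD(2)[OF T] and h = triangleD(3)[OF T]
  note s = triangleD(1)[OF D] and t = triangleD(2)[OF D] and r = triangleD(3)[OF D]
  note tg = cmp_hom[OF g t] and f\<kappa> = cmp_hom[OF \<kappa>(1) f]
  have "\<Sigma>a (f \<cdot> \<kappa>) = \<Sigma>a f \<cdot> h \<cdot> s"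
    using susp_cmp[OF \<kappa>(1) f] \<kappa>(2) cmp_assoc[OF s h susp_hom[OF f]] by simp
  also have "\<dots> = \<Sigma>a (pzero C k b)"
    using triangle_cmp_zero3[OF T] cmp_zero_left[OF s susp_obj[OF A_obj[OF A(2)]]]
      susp_zero[OF A_obj[OF A(3)] A_obj[OF A(2)]] by simp
  finally have zero: "f \<cdot> \<kappa> = pzero C k b"
    using susp_faithful[OF f\<kappa> zero_hom] A_obj A by blast
  \<comment> \<open>Since \<open>h\<close> kills \<open>s \<cdot> \<Sigma>a u\<close>, this arrow
    factors through a morphism from \<open>\<Sigma>o x\<close> to \<open>b\<close> and is zero. Then
    the double suspension of \<open>u\<close> factors through a morphism from
    \<open>\<Sigma>o (\<Sigma>o x)\<close> to \<open>q\<close>, again zero.\<close>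
  have "u = pzero C x k" if x: "x \<in> A" and u: "u \<in> hom_set C x k" "\<kappa> \<cdot> u = pzero C x a" for x u
  proof -
    note o = A_obj[OF x] A_obj[OF A(3)] and su = susp_hom[OF u(1)]
    note ssu = susp_hom[OF su]
    have "h \<cdot> (s \<cdot> \<Sigma>a u) = pzero C (\<Sigma>o x) (\<Sigma>o a)"
      using cmp_assoc[OF su s h] \<kappa>(2) susp_cmp[OF u(1) \<kappa>(1)] u(2) susp_zero[OF o(1) A_obj[OF A(1)]] by simp
    then obtain w where w: "w \<in> hom_set C (\<Sigma>o x) b" "g \<cdot> w = s \<cdot> \<Sigma>a u"
      using triangle_weak_kernel2[OF T cmp_hom[OF su s]] by blast
    then have "s \<cdot> \<Sigma>a u = pzero C (\<Sigma>o x) c"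
      using hom_susp_zero[OF x A(2) w(1)] cmp_zero_right[OF g susp_obj[OF o(1)]] by simp
    then have "\<Sigma>a s \<cdot> \<Sigma>a (\<Sigma>a u) = pzero C (\<Sigma>o (\<Sigma>o x)) (\<Sigma>o c)"
      using susp_cmp[OF su s] susp_zero[OF susp_obj[OF o(1)] hom_obj(2)[OF s]] by simp
    then obtain v where v: "v \<in> hom_set C (\<Sigma>o (\<Sigma>o x)) q" "r \<cdot> v = \<Sigma>a (\<Sigma>a u)"
      using triangle_weak_kernel3[OF D ssu] by blast
    then have "\<Sigma>a (\<Sigma>a u) = \<Sigma>a (\<Sigma>a (pzero C x k))"
      using hom_susp_susp_zero[OF x A(4) v(1)] cmp_zero_right[OF r] susp_zero susp_obj o by simp
    then have "\<Sigma>a u = \<Sigma>a (pzero C x k)"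
      using susp_faithful[OF su susp_hom[OF zero_hom[OF o]]] by blast
    then show ?thesis using susp_faithful[OF u(1) zero_hom[OF o]] by blast
  qed
  then have mono: "is_mono B \<kappa>" using is_mono_B_iff[OF \<kappa>(1) A(3,1)] by blast
  \<comment> \<open>Lift \<open>\<Sigma>a u\<close> through \<open>h\<close> to \<open>c\<close>;
    the lift followed by \<open>t\<close> goes from \<open>\<Sigma>o x\<close> to \<open>q\<close>,
    hence is zero, so it lifts further through \<open>s\<close>. Fullness desuspends the
    result.\<close>
  have "\<exists>v \<in> hom_set C x k. \<kappa> \<cdot> v = u"
    if x: "x \<in> A" and u: "u \<in> hom_set C x a" "f \<cdot> u = pzero C x b" for x u
  proof -
    note su = susp_hom[OF u(1)]
    have "\<Sigma>a f \<cdot> \<Sigma>a u = pzero C (\<Sigma>o x) (\<Sigma>o b)"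
      using susp_cmp[OF u(1) f] u(2) susp_zero[OF A_obj[OF x] A_obj[OF A(2)]] by simp
    then obtain w where w: "w \<in> hom_set C (\<Sigma>o x) c" "h \<cdot> w = \<Sigma>a u"
      using triangle_weak_kernel3[OF T su] by blast
    then obtain v' where v': "v' \<in> hom_set C (\<Sigma>o x) (\<Sigma>o k)" "s \<cdot> v' = w"
      using triangle_weak_kernel[OF D w(1)] hom_susp_zero[OF x A(4) cmp_hom[OF w(1) t]] by blast
    then obtain v where v: "v \<in> hom_set C x k" "\<Sigma>a v = v'"
      using susp_full[OF v'(1) A_obj[OF x] A_obj[OF A(3)]] by blast
    have "\<Sigma>a (\<kappa> \<cdot> v) = h \<cdot> (s \<cdot> v')"
      using susp_cmp[OF v(1) \<kappa>(1)] v(2) \<kappa>(2) cmp_assoc[OF v'(1) s h] by simp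
    also have "\<dots> = \<Sigma>a u" using v'(2) w(2) by simp
    finally show ?thesis using susp_faithful[OF cmp_hom[OF v(1) \<kappa>(1)] u(1)] v(1) by blast
  qed
  then show "is_kernel B \<kappa> f" using is_kernel_B_iff[OF \<kappa>(1) f A(3,1,2)] zero mono by blast
  have zero': "t \<cdot> g \<cdot> f = pzero C a q"
    using cmp_assoc[OF f g t] triangle_cmp_zero[OF T] cmp_zero_right[OF t A_obj[OF A(1)]] by simp
  \<comment> \<open>Here \<open>u \<cdot> t\<close> factors through a morphism from
    \<open>\<Sigma>o a\<close> to \<open>x\<close>, hence is zero, so \<open>u\<close> factors
    through one from \<open>\<Sigma>o (\<Sigma>o k)\<close> to \<open>x\<close>.\<close>
  have "u = pzero C q x" if x: "x \<in> A" and u: "u \<in> hom_set C q x" "u \<cdot> (t \<cdot> g) = pzero C b x" for x u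
  proof -
    note ut = cmp_hom[OF t u(1)]
    have "u \<cdot> t \<cdot> g = pzero C b x" using cmp_assoc[OF g t u(1)] u(2) by simp
    then obtain w where w: "w \<in> hom_set C (\<Sigma>o a) x" "w \<cdot> h = u \<cdot> t"
      using triangle_weak_cokernel2[OF T ut] by blast
    then have "u \<cdot> t = pzero C c x"
      using hom_susp_zero[OF A(1) x w(1)] cmp_zero_left[OF h A_obj[OF x]] by simp
    then obtain v where v: "v \<in> hom_set C (\<Sigma>o (\<Sigma>o k)) x" "v \<cdot> r = u"
      using triangle_weak_cokernel2[OF D u(1)] by blast
    then show ?thesis using hom_susp_susp_zero[OF A(3) x v(1)] cmp_zero_left[OF r A_obj[OF x]] by simp
  qed
  then have epi: "is_epi B (t \<cdot> g)" using is_epi_B_iff[OF tg A(2,4)] by blast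
  \<comment> \<open>Extend \<open>u\<close> along \<open>g\<close> to \<open>c\<close>; the
    restriction along \<open>s\<close> is a morphism from \<open>\<Sigma>o k\<close> to
    \<open>x\<close>, hence zero, so the extension descends along \<open>t\<close>.\<close>
  have "\<exists>v \<in> hom_set C q x. v \<cdot> (t \<cdot> g) = u"
    if x: "x \<in> A" and u: "u \<in> hom_set C b x" "u \<cdot> f = pzero C a x" for x u
  proof -
    obtain w where w: "w \<in> hom_set C c x" "w \<cdot> g = u" using triangle_weak_cokernel[OF T u] by blast
    then obtain v where v: "v \<in> hom_set C q x" "v \<cdot> t = w"
      using triangle_weak_cokernel[OF D w(1)] hom_susp_zero[OF A(3) x cmp_hom[OF s w(1)]] by blast
    then show ?thesis using cmp_assoc[OF g t v(1)] w(2) by auto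
  qed
  then show "is_cokernel B (t \<cdot> g) f" using is_cokernel_B_iff[OF tg f A(4,1,2)] zero' epi by blast
qed

end

section \<open>From the inclusion of star products to a proper abelian subcategory\<close>

locale star_swapping_subcategory = vanishing_subcategory +
  assumes star_swap: "star C A (\<Sigma>o ` A) \<subseteq> star C (\<Sigma>o ` A) A"
begin

interpretation B: additive_category B
  by (rule additive_full_subcategory[OF additive])

lemma cone_extension:
  assumes f: "f \<in> hom_set C a b" and A: "a \<in> A" "b \<in> A"
  obtains c g h k q s t r \<kappa> where "triangle a b c f g h" "triangle (\<Sigma>o k) c q s t r"
    "k \<in> A" "q \<in> A" "\<kappa> \<in> hom_set C k a" "\<Sigma>a \<kappa> = h \<cdot> s"
proof -
  obtain c g h where T: "triangle a b c f g h" using cone_exists[OF f] .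
  note g = triangleD(2)[OF T] and h = triangleD(3)[OF T]
  have "short_triangle C g h"
    using triangleD(4)[OF triangle_rotate[OF T]] by (auto simp: short_triangle_def)
  then have "c \<in> star C A (\<Sigma>o ` A)" unfolding star_def using A g h hom_obj[OF g] by blast
  then obtain k q s t where kq: "k \<in> A" "q \<in> A" and s: "s \<in> hom_set C (\<Sigma>o k) c"
    and t: "t \<in> hom_set C c q" and "short_triangle C s t"
    using star_swap unfolding star_def by blast
  then obtain r where D: "triangle (\<Sigma>o k) c q s t r" using short_triangleE by blast
  obtain \<kappa> where "\<kappa> \<in> hom_set C k a" "\<Sigma>a \<kappa> = h \<cdot> s"
    using susp_full[OF cmp_hom[OF s h]] A_obj kq A by blast
  then show ?thesis using that T D kq by blast
qed

lemma mono_triangle: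
  assumes f: "f \<in> hom_set C a b" and A: "a \<in> A" "b \<in> A" and mono: "is_mono B f"
  obtains c g h where "c \<in> A" "triangle a b c f g h"
proof -
  obtain c g h k q s t r \<kappa> where T: "triangle a b c f g h" and D: "triangle (\<Sigma>o k) c q s t r"
    and kq: "k \<in> A" "q \<in> A" and \<kappa>: "\<kappa> \<in> hom_set C k a" "\<Sigma>a \<kappa> = h \<cdot> s"
    using cone_extension[OF f A] .
  note k = A_obj[OF kq(1)]
  note ik = ident_hom[OF k]
  note ker = cone_extension_kernel_cokernel(1)[OF T D A kq \<kappa>]
  \<comment> \<open>The kernel \<open>\<kappa>\<close> satisfies
    \<open>f \<cdot> \<kappa> = 0\<close> and \<open>f\<close> is mono. A zero arrow that is itself
    mono has a zero source, whence \<open>k\<close> is zero.\<close>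
  have "\<kappa> = pzero C k a"
    using ker is_kernel_B_iff[OF \<kappa>(1) f kq(1) A] mono is_mono_B_iff[OF f A] kq(1) \<kappa>(1) by blast
  then have "\<kappa> \<cdot> ident C k = pzero C k a" using cmp_ident_right[OF \<kappa>(1)] by simp
  then have "ident C k = pzero C k k"
    using ker is_kernel_B_iff[OF \<kappa>(1) f kq(1) A] is_mono_B_iff[OF \<kappa>(1) kq(1) A(1)] kq(1) ik by blast
  then have zk: "zero_object C (\<Sigma>o k)" using susp_zero_object zero_objectI[OF k] by blast
  note s = triangleD(1)[OF D] and t = triangleD(2)[OF D] and r = triangleD(3)[OF D]
  note c = hom_obj(1)[OF t] and q = hom_obj(2)[OF t]
  have s0: "s = pzero C (\<Sigma>o k) c" and r0: "r = pzero C q (\<Sigma>o (\<Sigma>o k))"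
    using from_zero_object[OF zk s] to_zero_object[OF susp_zero_object[OF zk] r] by auto
  \<comment> \<open>As \<open>s\<close> is zero, the identity of \<open>c\<close> factors through
    \<open>t\<close>, giving a left inverse \<open>t'\<close>. As \<open>r\<close> is zero,
    \<open>t\<close> is epi, so the inverse is two-sided and \<open>c\<close> is isomorphic to
    \<open>q\<close>.\<close>
  have "ident C c \<cdot> s = pzero C (\<Sigma>o k) c" using cmp_ident_left[OF s] s0 by simp
  then obtain t' where t': "t' \<in> hom_set C q c" "t' \<cdot> t = ident C c"
    using triangle_weak_cokernel[OF D ident_hom[OF c]] by blast
  have "is_epi C t" using triangle_epi D r0 by blast
  moreover have "t \<cdot> t' \<cdot> t = ident C q \<cdot> t"
    using cmp_assoc[OF t t'(1) t] t'(2) cmp_ident_right[OF t] cmp_ident_left[OF t] by simp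
  ultimately have "t \<cdot> t' = ident C q"
    using epi_cancel[OF _ t cmp_hom[OF t'(1) t] ident_hom[OF q]] by blast
  then have "isomorphic C q c" using isomorphicI[OF t'(1) t] t'(2) by blast
  then have "c \<in> A" using additive kq(2) c unfolding additive_subcategory_def by blast
  then show ?thesis using that T by blast
qed

lemma epi_triangle:
  assumes f: "f \<in> hom_set C a b" and A: "a \<in> A" "b \<in> A" and epi: "is_epi B f"
  obtains k \<kappa> m where "k \<in> A" "triangle k a b \<kappa> f m"
proof -
  obtain c g h k q s t r \<kappa> where T: "triangle a b c f g h" and D: "triangle (\<Sigma>o k) c q s t r"
    and kq: "k \<in> A" "q \<in> A" and \<kappa>: "\<kappa> \<in> hom_set C k a" "\<Sigma>a \<kappa> = h \<cdot> s"
    using cone_extension[OF f A] .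
  note g = triangleD(2)[OF T] and h = triangleD(3)[OF T]
  note s = triangleD(1)[OF D] and t = triangleD(2)[OF D] and r = triangleD(3)[OF D]
  note c = hom_obj(1)[OF t] and q = hom_obj(2)[OF t] and tg = cmp_hom[OF g t]
  note iq = ident_hom[OF q] and ic = ident_hom[OF c]
  note coker = cone_extension_kernel_cokernel(2)[OF T D A kq \<kappa>]
  \<comment> \<open>Dually, the cokernel \<open>t \<cdot> g\<close> of an epi is zero, which makes
    \<open>q\<close> zero and then \<open>s\<close> an isomorphism with inverse
    \<open>s'\<close>.\<close>
  have "t \<cdot> g = pzero C b q"
    using coker is_cokernel_B_iff[OF tg f kq(2) A] epi is_epi_B_iff[OF f A] kq(2) tg by blast
  then have "ident C q \<cdot> (t \<cdot> g) = pzero C b q" using cmp_ident_left[OF tg] by simp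
  then have "ident C q = pzero C q q"
    using coker is_cokernel_B_iff[OF tg f kq(2) A] is_epi_B_iff[OF tg A(2) kq(2)] kq(2) iq by blast
  then have zq: "zero_object C q" using zero_objectI[OF q] by blast
  have t0: "t = pzero C c q" and r0: "r = pzero C q (\<Sigma>o (\<Sigma>o k))"
    using to_zero_object[OF zq t] from_zero_object[OF zq r] by auto
  have "t \<cdot> ident C c = pzero C c q" using cmp_ident_right[OF t] t0 by simp
  then obtain s' where s': "s' \<in> hom_set C c (\<Sigma>o k)" "s \<cdot> s' = ident C c"
    using triangle_weak_kernel[OF D ic] by blast
  note sk = hom_obj(1)[OF s]
  have "is_mono C s" using triangle_mono D r0 by blast
  moreover have "s \<cdot> (s' \<cdot> s) = s \<cdot> ident C (\<Sigma>o k)"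
    using cmp_assoc[OF s s'(1) s] s'(2) cmp_ident_right[OF s] cmp_ident_left[OF s] by simp
  ultimately have s's: "s' \<cdot> s = ident C (\<Sigma>o k)"
    using mono_cancel[OF _ s cmp_hom[OF s s'(1)] ident_hom[OF sk]] by blast
  have iso: "is_iso C s'" using is_iso_iff[OF s'(1)] s s'(2) s's by blast
  note a = A_obj[OF A(1)] and b = A_obj[OF A(2)]
  note m = cmp_hom[OF g s'(1)] and hs = cmp_hom[OF s h]
  have h_eq: "\<Sigma>a (ident C a) \<cdot> h = h \<cdot> s \<cdot> s'"
    using susp_ident[OF a] cmp_ident_left[OF h] cmp_assoc[OF s'(1) s h] s'(2) cmp_ident_right[OF h] by simp
  \<comment> \<open>Replace \<open>c\<close> by \<open>\<Sigma>o k\<close> along \<open>s'\<close>.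
    The new third arrow is \<open>\<Sigma>a \<kappa>\<close>, so rotating back produces a triangle
    starting with \<open>pneg C \<kappa>\<close>.\<close>
  have "(f, s' \<cdot> g, h \<cdot> s) \<in> tri C"
    by (rule TR1_iso[OF triangleD(4)[OF T] f g h f m hs ident_hom[OF a] ident_hom[OF b] s'(1)
          is_iso_ident[OF a] is_iso_ident[OF b] iso _ _ h_eq])
      (simp_all add: cmp_ident_left[OF f] cmp_ident_right[OF f] cmp_ident_right[OF m])
  moreover have "pneg C (\<Sigma>a (pneg C \<kappa>)) = h \<cdot> s"
    using susp_neg[OF \<kappa>(1)] \<kappa>(2) neg_neg[OF hs] by simp
  ultimately have "(pneg C \<kappa>, f, s' \<cdot> g) \<in> tri C" using TR2[OF neg_hom[OF \<kappa>(1)] f m] by simp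
  then have "triangle k a b (pneg C \<kappa>) f (s' \<cdot> g)"
    using neg_hom[OF \<kappa>(1)] f m by (simp add: triangle_def)
  then show ?thesis using that kq by blast
qed

lemma abelian: "abelian_category B"
proof (intro abelian_category.intro abelian_category_axioms.intro, goal_cases)
  \<comment> \<open>The cases are additivity, kernels, cokernels, monos as kernels and epis as
    cokernels.\<close>
  case 1 show ?case by (rule B.additive_category_axioms)
next
  case (2 f)
  then obtain a b where f: "f \<in> hom_set C a b" and A: "a \<in> A" "b \<in> A" by (auto simp: hom_set_def)
  obtain c g h k q s t r \<kappa> where T: "triangle a b c f g h" and D: "triangle (\<Sigma>o k) c q s t r"
    and kq: "k \<in> A" "q \<in> A" and \<kappa>: "\<kappa> \<in> hom_set C k a" "\<Sigma>a \<kappa> = h \<cdot> s"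
    using cone_extension[OF f A] .
  then show ?case using cone_extension_kernel_cokernel(1)[OF T D A kq \<kappa>] by blast
next
  case (3 f)
  then obtain a b where f: "f \<in> hom_set C a b" and A: "a \<in> A" "b \<in> A" by (auto simp: hom_set_def)
  obtain c g h k q s t r \<kappa> where T: "triangle a b c f g h" and D: "triangle (\<Sigma>o k) c q s t r"
    and kq: "k \<in> A" "q \<in> A" and \<kappa>: "\<kappa> \<in> hom_set C k a" "\<Sigma>a \<kappa> = h \<cdot> s"
    using cone_extension[OF f A] .
  then show ?case using cone_extension_kernel_cokernel(2)[OF T D A kq \<kappa>] by blast
next
  case (4 f)
  then obtain a b where f: "f \<in> hom_set C a b" and A: "a \<in> A" "b \<in> A"
    by (auto simp: is_mono_def hom_set_def)
  obtain c g h where "c \<in> A" "triangle a b c f g h" using mono_triangle[OF f A 4] .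
  then show ?case using triangle_kernel_cokernel(1) A by blast
next
  case (5 f)
  then obtain a b where f: "f \<in> hom_set C a b" and A: "a \<in> A" "b \<in> A"
    by (auto simp: is_epi_def hom_set_def)
  obtain k \<kappa> m where "k \<in> A" "triangle k a b \<kappa> f m" using epi_triangle[OF f A 5] .
  then show ?case using triangle_kernel_cokernel(2) A by blast
qed

text \<open>For the forward direction, \<open>g\<close> ends a triangle with first arrow
  \<open>\<kappa>\<close>. Through \<open>m\<close> one finds that \<open>f\<close> and
  \<open>\<kappa>\<close> are the same subobject of \<open>b\<close>, and the triangle is
  transported from \<open>\<kappa>\<close> to \<open>f\<close>.\<close>

lemma short_exact_iff:
  assumes "f \<in> arr C" "g \<in> arr C"
  shows "short_exact B f g \<longleftrightarrow> src C f \<in> A \<and> tgt C f \<in> A \<and> tgt C g \<in> A \<and> short_triangle C f g"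
proof
  assume "short_exact B f g"
  then obtain a b c where "f \<in> hom_set B a b" "g \<in> hom_set B b c" and mono: "is_mono B f"
    and epi: "is_epi B g" and "\<exists>c m. is_cokernel B c f \<and> is_kernel B m c \<and> is_kernel B m g"
    by (rule B.short_exactE) (rule that)
  then obtain d m where d0: "is_cokernel B d f" and md: "is_kernel B m d" and mg: "is_kernel B m g"
    by blast
  have f: "f \<in> hom_set C a b" and g: "g \<in> hom_set C b c" and A: "a \<in> A" "b \<in> A" "c \<in> A"
    using \<open>f \<in> hom_set B a b\<close> \<open>g \<in> hom_set B b c\<close>
    by (auto simp: hom_set_full_subcategory split: if_splits)
  obtain q where d: "d \<in> hom_set C b q" and q: "q \<in> A"
    using d0 f by (auto simp: is_cokernel_def hom_set_def)
  obtain w where m: "m \<in> hom_set C w b" and w: "w \<in> A"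
    using mg g by (auto simp: is_kernel_def hom_set_def)
  obtain c0 g0 h0 where c0: "c0 \<in> A" and T: "triangle a b c0 f g0 h0" using mono_triangle[OF f A(1,2) mono] .
  obtain k \<kappa> n where k: "k \<in> A" and K: "triangle k b c \<kappa> g n" using epi_triangle[OF g A(2,3) epi] .
  note g0 = triangleD(2)[OF T] and \<kappa> = triangleD(1)[OF K] and n = triangleD(3)[OF K]
  have fker: "is_kernel B f g0" using triangle_kernel_cokernel(1)[OF T A(1,2) c0] .
  have \<kappa>ker: "is_kernel B \<kappa> g" using triangle_kernel_cokernel(1)[OF K k A(2,3)] .
  note kerf = fker[unfolded is_kernel_B_iff[OF f g0 A(1,2) c0]]
  note ker\<kappa> = \<kappa>ker[unfolded is_kernel_B_iff[OF \<kappa> g k A(2,3)]]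
  note kermd = md[unfolded is_kernel_B_iff[OF m d w A(2) q]]
  note kermg = mg[unfolded is_kernel_B_iff[OF m g w A(2,3)]]
  note cokd = d0[unfolded is_cokernel_B_iff[OF d f q A(1,2)]]
  \<comment> \<open>The cokernel \<open>d\<close> kills \<open>f\<close>, so \<open>f\<close>
    factors through its kernel \<open>m\<close>; thus \<open>g\<close> kills \<open>f\<close>, and
    \<open>f\<close> factors through \<open>\<kappa>\<close>.\<close>
  obtain u where u: "u \<in> hom_set C a w" "m \<cdot> u = f" using kermd cokd f A(1) by blast
  have "g \<cdot> f = pzero C a c"
    using cmp_assoc[OF u(1) m g] u(2) kermg cmp_zero_left[OF u(1) A_obj[OF A(3)]] by simp
  then obtain x where x: "x \<in> hom_set C a k" "\<kappa> \<cdot> x = f" using ker\<kappa> f A(1) by blast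
  \<comment> \<open>Conversely, \<open>\<kappa>\<close> factors through \<open>m\<close>, and
    \<open>g0\<close> factors through \<open>d\<close>, which kills \<open>m\<close>. So
    \<open>g0\<close> kills \<open>\<kappa>\<close>, and \<open>\<kappa>\<close> factors through the
    kernel \<open>f\<close> of \<open>g0\<close>.\<close>
  obtain v where v: "v \<in> hom_set C k w" "m \<cdot> v = \<kappa>" using kermg ker\<kappa> \<kappa> k by blast
  obtain e where e: "e \<in> hom_set C q c0" "e \<cdot> d = g0" using cokd kerf g0 c0 by blast
  have "g0 \<cdot> m = pzero C w c0"
    using cmp_assoc[OF m d e(1)] e(2) kermd cmp_zero_right[OF e(1) A_obj[OF w]] by simp
  then have "g0 \<cdot> \<kappa> = pzero C k c0"
    using cmp_assoc[OF v(1) m g0] v(2) cmp_zero_left[OF v(1) A_obj[OF c0]] by simp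
  then obtain y where y: "y \<in> hom_set C k a" "f \<cdot> y = \<kappa>" using kerf \<kappa> k by blast
  note ia = ident_hom[OF A_obj[OF A(1)]] and ik = ident_hom[OF A_obj[OF k]]
  note ib = ident_hom[OF A_obj[OF A(2)]] and ic = ident_hom[OF A_obj[OF A(3)]]
  \<comment> \<open>The comparison maps are mutually inverse because \<open>f\<close> and
    \<open>\<kappa>\<close> are mono in \<open>B\<close>.\<close>
  have "f \<cdot> (y \<cdot> x) = f \<cdot> ident C a"
    using cmp_assoc[OF x(1) y(1) f] y(2) x(2) cmp_ident_right[OF f] by simp
  then have yx: "y \<cdot> x = ident C a"
    using B.mono_cancel[OF mono, of a b "y \<cdot> x" a "ident C a"] f ia cmp_hom[OF x(1) y(1)] A hom_set_B by simp
  have "\<kappa> \<cdot> (x \<cdot> y) = \<kappa> \<cdot> ident C k"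
    using cmp_assoc[OF y(1) x(1) \<kappa>] y(2) x(2) cmp_ident_right[OF \<kappa>] by simp
  then have xy: "x \<cdot> y = ident C k"
    using B.mono_cancel[of \<kappa> k b "x \<cdot> y" k "ident C k"] ker\<kappa> \<kappa> ik cmp_hom[OF y(1) x(1)] A k hom_set_B by simp
  have iso: "is_iso C y" using is_iso_iff[OF y(1)] x(1) xy yx by blast
  note h = cmp_hom[OF n susp_hom[OF y(1)]]
  have "(f, g, \<Sigma>a y \<cdot> n) \<in> tri C"
    by (rule TR1_iso[OF triangleD(4)[OF K] \<kappa> g n f g h y(1) ib ic iso
          is_iso_ident[OF A_obj[OF A(2)]] is_iso_ident[OF A_obj[OF A(3)]]])
      (simp_all add: cmp_ident_left[OF \<kappa>] y(2) cmp_ident_left[OF g] cmp_ident_right[OF g] cmp_ident_right[OF h])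
  then show "src C f \<in> A \<and> tgt C f \<in> A \<and> tgt C g \<in> A \<and> short_triangle C f g"
    using f g A by (auto simp: short_triangle_def hom_set_def)
next
  assume r: "src C f \<in> A \<and> tgt C f \<in> A \<and> tgt C g \<in> A \<and> short_triangle C f g"
  then obtain h where h: "(f, g, h) \<in> tri C" by (auto simp: short_triangle_def)
  obtain a b c where T: "triangle a b c f g h" using tri_shape[OF h] h by (auto simp: triangle_def)
  have A: "a \<in> A" "b \<in> A" "c \<in> A" using r triangleD[OF T] by (auto simp: hom_set_def)
  obtain z where "zero_object B z" using B.ex_zero_object by blast
  then show "short_exact B f g" using B.short_exactI triangle_kernel_cokernel[OF T A] by blast
qed

end

section \<open>The equivalence\<close>

theorem theorem4:
  fixes C :: "('o, 'm) tricat" and A :: "'o set"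
  assumes "triangulated_category C"
    and "additive_subcategory C A"
    and "extension_closed C A"
    and "condition_E2 C A"
  shows "proper_abelian_subcategory C A \<longleftrightarrow>
    star C A (susp_obj C ` A) \<subseteq> star C (susp_obj C ` A) A"
proof
  interpret triangulated_category C by (rule assms(1))
  assume "proper_abelian_subcategory C A"
  then show "star C A (susp_obj C ` A) \<subseteq> star C (susp_obj C ` A) A"
    by (rule star_subset_if_proper_abelian)
next
  interpret triangulated_category C by (rule assms(1))
  assume swap: "star C A (susp_obj C ` A) \<subseteq> star C (susp_obj C ` A) A"
  have sub: "A \<subseteq> obj C" using assms(2) by (simp add: additive_subcategory_def)
  have van: "hom_set C a (desusp_obj C b) = {pzero C a (desusp_obj C b)}"
    "hom_set C a (desusp_obj C (desusp_obj C b)) = {pzero C a (desusp_obj C (desusp_obj C b))}"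
    if "a \<in> A" "b \<in> A" for a b
    using assms(4) that by (auto simp: condition_E2_def hom_vanishes_def)
  interpret star_swapping_subcategory C A
  proof (unfold_locales, goal_cases)
    case 1 show ?case by (rule assms(2))
  next
    case (2 a b f)
    then show ?case using hom_vanishes_susp[OF van(1)] sub by blast
  next
    case (3 a b f)
    have o: "a \<in> obj C" "b \<in> obj C" using 3 sub by auto
    \<comment> \<open>The two desuspensions on the target are moved across one at a time.\<close>
    have "hom_set C (susp_obj C a) (desusp_obj C b) = {pzero C (susp_obj C a) (desusp_obj C b)}"
      using hom_vanishes_susp[OF van(2)[OF 3(1,2)]] o desusp_obj by blast
    then show ?case using hom_vanishes_susp susp_obj o 3(3) by blast
  next
    case 4 show ?case by (rule swap)
  qed
  show "proper_abelian_subcategory C A"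
    unfolding proper_abelian_subcategory_def using assms(2) abelian short_exact_iff by blast
qed

end
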